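(* There exists a universal constant $b>0$ (not depending on $n$, $r$ or $c$) such that the following holds. Let $n,r$ be integers with $1\le r\le n/2$, let $c>0$, and let $k=\frac14 n(\log n+c)$ be an integer. Let $P$ be the probability measure on the hyperoctahedral group $\mathbb Z_2\wr S_n$ defined in the context, let $\widetilde{P^{*k}}$ be the probability measure on the homogeneous space $X=(\mathbb Z_2\wr S_n)/(S_r\times S_{n-r})$ induced by the $k$-fold convolution $P^{*k}$, and let $\widetilde U$ be the uniform probability measure on $X$. Then $$\|\widetilde{P^{*k}}-\widetilde U\|_{\mathrm{TV}}\ \le\ \tfrac12\Big[2^n\binom nr\Big]^{1/2}\|\widetilde{P^{*k}}-\widetilde U\|_2\ \le\ b e^{-c/2}.$$
   Context: Elements of $\mathbb Z_2\wr S_n$ are pairs $(\vec v;\pi)$ with $\vec v\in\mathbb Z_2^n$, $\pi\in S_n$, with product $(\vec v;\pi)(\vec w;\sigma)=(\vec v+\pi\vec w;\pi\sigma)$, where $(\pi\vec w)_i=w_{\pi^{-1}(i)}$. Let $K\cong S_r\times S_{n-r}$ be the subgroup of elements $(\vec 0;\kappa)$ with $\kappa$ mapping $\{1,\dots,r\}$ to itself and $\{r+1,\dots,n\}$ to itself; write also $\kappa\in K$ for such permutations, and $\mathbb Z_2\wr K=\{(\vec v;\kappa):\vec v\in\mathbb Z_2^n,\kappa\in K\}$. A signed transposition is an element $(\vec v;\tau)$ with $\tau=(i\,j)$ a transposition and $\vec v$ zero outside positions $i,j$. Let $T_2$ be the set of signed transpositions in $(\mathbb Z_2\wr K)\setminus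 K$ and $T_3$ the set of signed transpositions not in $\mathbb Z_2\wr K$. A signed identity is an element $(\vec u;e)$ with $\vec u$ having exactly one nonzero entry; let $\mathcal U$ be the set of all of them, $U_r$ those whose nonzero entry is in a position in $\{1,\dots,r\}$, and $U_{n-r}$ those whose nonzero entry is in a position in $\{r+1,\dots,n\}$. For a set $A$, $AK=\{ak:a\in A,k\in K\}$. (So $T_2K\setminus \mathcal UK$ consists of all $(\vec v;\kappa)$ with $\kappa\in K$ and $\vec v$ having exactly two nonzero entries, both in $\{1,\dots,r\}$ or both in $\{r+1,\dots,n\}$.) The probability measure $P$ on $\mathbb Z_2\wr S_n$ is given by $$P(g)=\begin{cases}\dfrac{n(n+1)-2r(n-r)}{4n^2\,r!(n-r)!}& g\in K,\\[2mm] \dfrac{r}{2n^2\,r!(n-r)!}& g\in U_rK,\\[2mm] \dfrac{n-r}{2n^2\,r!(n-r)!}& g\in U_{n-r}K,\\[2mm] \dfrac{1}{2n^2\,r!(n-r)!}& g\in T_2K\setminus\mathcal UK,\\[2mm] \dfrac{1}{2n^2\,r!(n-r)!}& g\in T_3K,\\[2mm] 0&\text{otherwise.}\end{cases}$$ $X$ is the set of left cosets of $K$ in $\mathbb Z_2\wr S_n$, so $|X|=2^n\binom nr$. A probability measure $R$ on $\mathbb Z_2\wr S_n$ induces $\widetilde R$ on $X$ by $\widetilde R(xK)=\sum_{k\in K}R(xk)$. Convolution: $(R_1*R_2)(g)=\sum_h R_1(gh^{-1})R_2(h)$; $P^{*k}$ is the convolution of $P$ with itself $k$ times. For probability measures $\mu,\nu$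 on $X$: $\|\mu-\nu\|_{\mathrm{TV}}=\frac12\sum_{x\in X}|\mu(x)-\nu(x)|$ and $\|\mu-\nu\|_2=\big(\sum_{x\in X}|\mu(x)-\nu(x)|^2\big)^{1/2}$ (unnormalized). $\log$ is the natural logarithm. *)

theory Defs
  imports Complex_Main "HOL-Library.Z2" "HOL-Algebra.Sym_Groups" "HOL-Algebra.Left_Coset"
begin

section \<open>The hyperoctahedral group\<close>

text \<open>A vector of length \<open>n\<close> over the integers mod 2 is a function \<open>nat \<Rightarrow> bit\<close> vanishing outside
  \<open>{1..n}\<close>, in analogy to \<^const>\<open>sym_group\<close>, whose elements fix every point outside \<open>{1..n}\<close>.\<close>

definition bit_vecs :: "nat \<Rightarrow> (nat \<Rightarrow> bit) set"
  where "bit_vecs n = {v. \<forall>i. i \<notin> {1..n} \<longrightarrow> v i = 0}"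

type_synonym signed_perm = "(nat \<Rightarrow> bit) \<times> (nat \<Rightarrow> nat)"

definition hyperoctahedral :: "nat \<Rightarrow> signed_perm monoid"
  where "hyperoctahedral n =
    \<lparr> carrier = bit_vecs n \<times> carrier (sym_group n),
      mult = (\<lambda>(v, \<pi>) (w, \<sigma>). (\<lambda>i. v i + w (inv' \<pi> i), \<pi> \<circ> \<sigma>)),
      one = (\<lambda>i. 0, id) \<rparr>"

text \<open>The permutations preserving both blocks \<open>{1..r}\<close> and \<open>{r + 1..n}\<close>.\<close>

definition block_perms :: "nat \<Rightarrow> nat \<Rightarrow> (nat \<Rightarrow> nat) set"
  where "block_perms n r =
    {\<kappa> \<in> carrier (sym_group n). \<kappa> ` {1..r} = {1..r} \<and> \<kappa> ` {r + 1..n} = {r + 1..n}}"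

definition block_subgroup :: "nat \<Rightarrow> nat \<Rightarrow> signed_perm set"
  where "block_subgroup n r = {\<lambda>i. 0} \<times> block_perms n r"

definition signed_block_subgroup :: "nat \<Rightarrow> nat \<Rightarrow> signed_perm set"
  where "signed_block_subgroup n r = bit_vecs n \<times> block_perms n r"

definition signed_transpositions :: "nat \<Rightarrow> signed_perm set"
  where "signed_transpositions n =
    {(v, transpose i j) | v i j.
      i \<in> {1..n} \<and> j \<in> {1..n} \<and> i \<noteq> j \<and> (\<forall>l. l \<notin> {i, j} \<longrightarrow> v l = 0)}"

text \<open>The signed identities whose nonzero entry has its position in \<open>A\<close>.\<close>

definition signed_identities :: "nat set \<Rightarrow> signed_perm set"
  where "signed_identities A = {(u, id) | u. \<exists>i\<in>A. \<forall>l. u l \<noteq> 0 \<longleftrightarrow> l = i}"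

definition T2 :: "nat \<Rightarrow> nat \<Rightarrow> signed_perm set"
  where "T2 n r = signed_transpositions n \<inter> (signed_block_subgroup n r - block_subgroup n r)"

definition T3 :: "nat \<Rightarrow> nat \<Rightarrow> signed_perm set"
  where "T3 n r = signed_transpositions n - signed_block_subgroup n r"

text \<open>The mass function of the one-step distribution. The sets in the case distinction are pairwise
  disjoint.\<close>

definition step_measure :: "nat \<Rightarrow> nat \<Rightarrow> signed_perm \<Rightarrow> real"
  where "step_measure n r g =
    (let G = hyperoctahedral n;
         K = block_subgroup n r;
         D = 2 * (real n)\<^sup>2 * fact r * fact (n - r)
     in if g \<in> K then (real n * (real n + 1) - 2 * real r * (real n - real r)) / (2 * D)
        else if g \<in> signed_identities {1..r} <#>\<^bsub>G\<^esub> K then real r / D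
        else if g \<in> signed_identities {r + 1..n} <#>\<^bsub>G\<^esub> K then (real n - real r) / D
        else if g \<in> (T2 n r <#>\<^bsub>G\<^esub> K) - (signed_identities {1..n} <#>\<^bsub>G\<^esub> K) then 1 / D
        else if g \<in> T3 n r <#>\<^bsub>G\<^esub> K then 1 / D
        else 0)"


section \<open>Convolution, homogeneous spaces and distances\<close>

text \<open>Measures on finite sets are given by their mass functions.\<close>

definition convolution ::
    "('a, 'm) monoid_scheme \<Rightarrow> ('a \<Rightarrow> real) \<Rightarrow> ('a \<Rightarrow> real) \<Rightarrow> 'a \<Rightarrow> real"
  where "convolution G R1 R2 g = (\<Sum>h\<in>carrier G. R1 (g \<otimes>\<^bsub>G\<^esub> inv\<^bsub>G\<^esub> h) * R2 h)"

primrec conv_power :: "('a, 'm) monoid_scheme \<Rightarrow> ('a \<Rightarrow> real) \<Rightarrow> nat \<Rightarrow> 'a \<Rightarrow> real"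
  where
    "conv_power G R 0 = (\<lambda>g. if g = \<one>\<^bsub>G\<^esub> then 1 else 0)"
  | "conv_power G R (Suc k) = convolution G R (conv_power G R k)"

text \<open>The measure induced on left cosets gives \<open>xK\<close> the mass \<open>\<Sum>k\<in>K. R (xk)\<close>; see
  \<open>coset_measure_l_coset\<close> below.\<close>

definition coset_measure :: "('a \<Rightarrow> real) \<Rightarrow> 'a set \<Rightarrow> real"
  where "coset_measure R C = (\<Sum>g\<in>C. R g)"

lemma coset_measure_l_coset:
  assumes "group G" "subgroup K G" "x \<in> carrier G"
  shows "coset_measure R (x <#\<^bsub>G\<^esub> K) = (\<Sum>k\<in>K. R (x \<otimes>\<^bsub>G\<^esub> k))"
proof -
  interpret group G by fact
  have "inj_on (\<lambda>k. x \<otimes>\<^bsub>G\<^esub> k) K"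
    using assms(3) subgroup.mem_carrier[OF assms(2)] by (auto intro!: inj_onI)
  moreover have "x <#\<^bsub>G\<^esub> K = (\<lambda>k. x \<otimes>\<^bsub>G\<^esub> k) ` K"
    by (auto simp: l_coset_def)
  ultimately show ?thesis
    by (simp add: coset_measure_def sum.reindex)
qed

definition uniform_measure :: "'a set \<Rightarrow> 'a \<Rightarrow> real"
  where "uniform_measure X x = 1 / real (card X)"

definition tv_dist :: "'a set \<Rightarrow> ('a \<Rightarrow> real) \<Rightarrow> ('a \<Rightarrow> real) \<Rightarrow> real"
  where "tv_dist X \<mu> \<nu> = 1 / 2 * (\<Sum>x\<in>X. \<bar>\<mu> x - \<nu> x\<bar>)"

definition l2_dist :: "'a set \<Rightarrow> ('a \<Rightarrow> real) \<Rightarrow> ('a \<Rightarrow> real) \<Rightarrow> real"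
  where "l2_dist X \<mu> \<nu> = sqrt (\<Sum>x\<in>X. \<bar>\<mu> x - \<nu> x\<bar>\<^sup>2)"


section \<open>Group-theoretic facts\<close>

lemma hyperoctahedral_carrier_iff:
  "(v, \<pi>) \<in> carrier (hyperoctahedral n) \<longleftrightarrow> v \<in> bit_vecs n \<and> \<pi> permutes {1..n}"
  by (simp add: hyperoctahedral_def sym_group_carrier)

lemma hyperoctahedral_mult:
  "(v, \<pi>) \<otimes>\<^bsub>hyperoctahedral n\<^esub> (w, \<sigma>) = (\<lambda>i. v i + w (inv' \<pi> i), \<pi> \<circ> \<sigma>)"
  by (simp add: hyperoctahedral_def)

lemma hyperoctahedral_one: "\<one>\<^bsub>hyperoctahedral n\<^esub> = (\<lambda>i. 0, id)"
  by (simp add: hyperoctahedral_def)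

lemma bit_vecs_permute:
  assumes "w \<in> bit_vecs n" "\<pi> permutes {1..n}"
  shows "(\<lambda>i. w (\<pi> i)) \<in> bit_vecs n"
  using assms permutes_not_in[OF assms(2)] by (auto simp: bit_vecs_def)

lemma group_hyperoctahedral: "group (hyperoctahedral n)"
proof (rule groupI)
  fix x y assume "x \<in> carrier (hyperoctahedral n)" "y \<in> carrier (hyperoctahedral n)"
  then show "x \<otimes>\<^bsub>hyperoctahedral n\<^esub> y \<in> carrier (hyperoctahedral n)"
    using bit_vecs_permute[OF _ permutes_inv]
    by (cases x; cases y)
      (auto simp: hyperoctahedral_carrier_iff hyperoctahedral_mult permutes_compose bit_vecs_def)
next
  show "\<one>\<^bsub>hyperoctahedral n\<^esub> \<in> carrier (hyperoctahedral n)"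
    by (simp add: hyperoctahedral_one hyperoctahedral_carrier_iff permutes_id bit_vecs_def)
next
  fix x y z
  assume "x \<in> carrier (hyperoctahedral n)" "y \<in> carrier (hyperoctahedral n)"
    "z \<in> carrier (hyperoctahedral n)"
  then show "x \<otimes>\<^bsub>hyperoctahedral n\<^esub> y \<otimes>\<^bsub>hyperoctahedral n\<^esub> z =
      x \<otimes>\<^bsub>hyperoctahedral n\<^esub> (y \<otimes>\<^bsub>hyperoctahedral n\<^esub> z)"
    by (cases x; cases y; cases z)
      (auto simp: hyperoctahedral_carrier_iff hyperoctahedral_mult o_inv_distrib permutes_bij
        comp_assoc fun_eq_iff add.assoc simp del: add_bit_eq_xor)
next
  fix x assume "x \<in> carrier (hyperoctahedral n)"
  then show "\<one>\<^bsub>hyperoctahedral n\<^esub> \<otimes>\<^bsub>hyperoctahedral n\<^esub> x = x"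
    by (cases x) (simp add: hyperoctahedral_one hyperoctahedral_mult del: add_bit_eq_xor)
next
  fix x assume x: "x \<in> carrier (hyperoctahedral n)"
  obtain v \<pi> where [simp]: "x = (v, \<pi>)" by (cases x)
  have \<pi>: "v \<in> bit_vecs n" "\<pi> permutes {1..n}"
    using x by (auto simp: hyperoctahedral_carrier_iff)
  show "\<exists>y\<in>carrier (hyperoctahedral n). y \<otimes>\<^bsub>hyperoctahedral n\<^esub> x = \<one>\<^bsub>hyperoctahedral n\<^esub>"
  proof (rule bexI)
    have "a + a = 0" for a :: bit
      by (cases a) simp_all
    then show "(\<lambda>i. v (\<pi> i), inv' \<pi>) \<otimes>\<^bsub>hyperoctahedral n\<^esub> x = \<one>\<^bsub>hyperoctahedral n\<^esub>"
      using \<pi> by (simp add: hyperoctahedral_mult hyperoctahedral_one permutes_inv_inv permutes_inv_o)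
    show "(\<lambda>i. v (\<pi> i), inv' \<pi>) \<in> carrier (hyperoctahedral n)"
      using \<pi> bit_vecs_permute permutes_inv by (auto simp: hyperoctahedral_carrier_iff)
  qed
qed

lemma subgroup_block_subgroup: "subgroup (block_subgroup n r) (hyperoctahedral n)"
proof -
  interpret group "hyperoctahedral n" by (rule group_hyperoctahedral)
  have im: "inv' \<kappa> ` A = A" if "\<kappa> permutes S" "\<kappa> ` A = A" for \<kappa> :: "nat \<Rightarrow> nat" and A S
    using that by (metis bij_is_inj image_inv_f_f permutes_bij)
  have im_comp: "(\<kappa> \<circ> \<sigma>) ` A = A" if "\<kappa> ` A = A" "\<sigma> ` A = A"
    for \<kappa> \<sigma> :: "nat \<Rightarrow> nat" and A
    using that by (simp only: image_comp[symmetric])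
  have inv: "inv\<^bsub>hyperoctahedral n\<^esub> (\<lambda>i. 0, \<kappa>) = (\<lambda>i. 0, inv' \<kappa>)"
    if "\<kappa> permutes {1..n}" for \<kappa>
    using that
    by (intro inv_equality)
      (auto simp: hyperoctahedral_mult hyperoctahedral_one hyperoctahedral_carrier_iff
        bit_vecs_def permutes_inv permutes_inv_o)
  show ?thesis
  proof (rule subgroupI)
    show "block_subgroup n r \<subseteq> carrier (hyperoctahedral n)"
      by (auto simp: block_subgroup_def block_perms_def hyperoctahedral_def bit_vecs_def)
    have "(\<lambda>i. 0, id) \<in> block_subgroup n r"
      by (auto simp: block_subgroup_def block_perms_def sym_group_carrier permutes_id)
    then show "block_subgroup n r \<noteq> {}" by blast
  next
    fix a assume "a \<in> block_subgroup n r"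
    then show "inv\<^bsub>hyperoctahedral n\<^esub> a \<in> block_subgroup n r"
      using im by (auto simp: block_subgroup_def block_perms_def sym_group_carrier inv permutes_inv)
  next
    fix a b assume "a \<in> block_subgroup n r" "b \<in> block_subgroup n r"
    then obtain \<kappa> \<sigma> where eq: "a = (\<lambda>i. 0, \<kappa>)" "b = (\<lambda>i. 0, \<sigma>)"
      and "\<kappa> \<in> block_perms n r" "\<sigma> \<in> block_perms n r"
      by (auto simp: block_subgroup_def)
    then have "\<kappa> \<circ> \<sigma> \<in> block_perms n r"
      unfolding block_perms_def sym_group_carrier mem_Collect_eq
      by (elim conjE, intro conjI im_comp permutes_compose)
    then show "a \<otimes>\<^bsub>hyperoctahedral n\<^esub> b \<in> block_subgroup n r"
      by (simp add: eq hyperoctahedral_mult block_subgroup_def)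
  qed
qed

end

theory Submission
  imports Defs "HOL-Analysis.L2_Norm"
begin

text \<open>
A coset of \<open>K\<close> is determined by a state \<open>(v, A)\<close>: a sign vector \<open>v\<close> and the \<open>r\<close>-subset \<open>A\<close> of \<open>{1..n}\<close>
onto which the permutations in the coset map the first block. The measure \<open>P\<close> is invariant under
\<open>K\<close> from both sides, and this turns \<open>P\<^sup>*\<^sup>k\<close> into a Markov chain on states with a simple description: choose
an ordered pair \<open>(i, j)\<close> of positions uniformly, apply the transposition of \<open>i\<close> and \<open>j\<close> to \<open>A\<close>, and replace
the signs at positions \<open>i\<close> and \<open>j\<close> by independent uniform ones (\<open>coset_mass_Suc\<close>).

A character of the sign group, given by a set \<open>S\<close> of positions, is annihilated by every step that
touches \<open>S\<close>. On the Fourier component \<open>S\<close> one step therefore acts on functions of \<open>A\<close> as \<open>1 / n\<^sup>2\<close> times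
\<open>swap_sum ({1..n} - S)\<close>, the sum over the transpositions of all ordered pairs from the complement of \<open>S\<close>
(\<open>fourier_mass_eq\<close>). With Parseval's identity, self-adjointness and the averaging over \<open>A\<close> that the
symmetric group provides, \<open>|X|\<close> times the squared \<open>l\<^sup>2\<close> distance becomes a normalised sum of
diagonal entries of the powers \<open>(swap_sum T) ^^ (2 * k)\<close> over all sets \<open>T\<close> and \<open>A\<close>, minus \<open>1\<close>
(\<open>card_lcosets_mult_l2_dist_squared\<close>).

These entries depend only on the part of \<open>A\<close> inside \<open>T\<close>, so the traces of \<open>swap_sum T\<close> on the
\<open>t\<close>-subsets of \<open>T\<close> are what has to be known. Let \<open>D\<close> and \<open>U\<close> be the operators that sum a function over
the sets obtained by adding, respectively removing, a point. Then \<open>swap_sum T\<close> is \<open>\<lambda>\<^sub>t + 2 U D\<close> on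
\<open>t\<close>-subsets and \<open>\<lambda>\<^sub>t + 2 D U\<close> on \<open>(t - 1)\<close>-subsets with the same scalar
\<open>\<lambda>\<^sub>t = m\<^sup>2 - 2 t (m - t + 1)\<close>, \<open>m = |T|\<close>. Cyclicity of the trace makes the traces of the \<open>N\<close>-th powers on the two
layers differ by exactly \<open>\<lambda>\<^sub>t ^ N\<close> times the difference of the dimensions (\<open>swap_trace_Suc_diff\<close>). This gives
all traces without eigenvectors and without representation theory of the symmetric group.

For \<open>4 k = n (ln n + c)\<close> the main contribution \<open>S = {}\<close>, \<open>j = 0\<close> equals \<open>1\<close> and cancels. Each
position in \<open>S\<close> costs a factor \<open>exp (- c) / n\<close> and brings a factor \<open>2\<close>, as it may belong to \<open>A\<close> or
not. The terms with \<open>j \<ge> 1\<close> are bounded by \<open>exp (- c)\<close> times a convergent series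
(\<open>binomial_exp_le_tail_term\<close>). The total is at most \<open>(1 + 2 exp (- c) / n) ^ n (1 + O(exp (- c)))\<close>,
so that \<open>|X|\<close> times the squared distance is \<open>O(exp (- c))\<close>.
\<close>


section \<open>Random transpositions acting on the subsets of a finite set\<close>

text \<open>This is \<open>(card T)\<^sup>2\<close> times the operator of one random transposition step in which both
positions are chosen independently and uniformly from \<open>T\<close>; the pairs with \<open>i = j\<close> give the holding
probability.\<close>

definition swap_sum :: "'a set \<Rightarrow> ('a set \<Rightarrow> real) \<Rightarrow> 'a set \<Rightarrow> real"
  where "swap_sum T f A = (\<Sum>i\<in>T. \<Sum>j\<in>T. f (transpose i j ` A))"

text \<open>For a linear operator \<open>F\<close> on functions, \<open>F (point_mass A) B\<close> is the entry of its matrix in row \<open>B\<close>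
and column \<open>A\<close>.\<close>

abbreviation point_mass :: "'a \<Rightarrow> 'a \<Rightarrow> real"
  where "point_mass x \<equiv> \<lambda>y. of_bool (y = x)"

definition subsets_of_card :: "'a set \<Rightarrow> nat \<Rightarrow> 'a set set"
  where "subsets_of_card T t = {A. A \<subseteq> T \<and> card A = t}"

definition down_sum :: "'a set \<Rightarrow> ('a set \<Rightarrow> real) \<Rightarrow> 'a set \<Rightarrow> real"
  where "down_sum T f A = (\<Sum>a\<in>T - A. f (insert a A))"

definition up_sum :: "('a set \<Rightarrow> real) \<Rightarrow> 'a set \<Rightarrow> real"
  where "up_sum f A = (\<Sum>a\<in>A. f (A - {a}))"

lemma finite_subsets_of_card [simp]: "finite T \<Longrightarrow> finite (subsets_of_card T t)"
  by (rule finite_subset[of _ "Pow T"]) (auto simp: subsets_of_card_def)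

lemma card_subsets_of_card: "finite T \<Longrightarrow> card (subsets_of_card T t) = card T choose t"
  by (simp add: subsets_of_card_def n_subsets)

lemma permutes_image_subsets_of_card:
  assumes "p permutes T" "A \<in> subsets_of_card T t"
  shows "p ` A \<in> subsets_of_card T t"
proof -
  have "p ` A \<subseteq> p ` T"
    using assms by (auto simp: subsets_of_card_def)
  moreover have "card (p ` A) = card A"
    by (rule card_image) (rule inj_on_subset[OF permutes_inj[OF assms(1)]], simp)
  ultimately show ?thesis
    using assms by (simp add: subsets_of_card_def permutes_image)
qed

lemma transpose_permutes: "i \<in> T \<Longrightarrow> j \<in> T \<Longrightarrow> transpose i j permutes T"
  by (rule permutes_swap_id)

lemma swap_sum_power_cong:
  assumes "\<And>A. A \<in> subsets_of_card T t \<Longrightarrow> f A = g A" and "A \<in> subsets_of_card T t"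
  shows "(swap_sum T ^^ N) f A = (swap_sum T ^^ N) g A"
  using assms(2)
proof (induction N arbitrary: A)
  case (Suc N)
  then show ?case
    by (auto simp: swap_sum_def permutes_image_subsets_of_card transpose_permutes
        intro!: sum.cong)
qed (use assms(1) in auto)

lemma swap_sum_power_sum:
  "(swap_sum T ^^ N) (\<lambda>A. \<Sum>x\<in>X. f x A) B = (\<Sum>x\<in>X. (swap_sum T ^^ N) (f x) B)"
proof (induction N arbitrary: B)
  case (Suc N)
  have "(\<Sum>i\<in>T. \<Sum>j\<in>T. \<Sum>x\<in>X. (swap_sum T ^^ N) (f x) (transpose i j ` B)) =
    (\<Sum>x\<in>X. \<Sum>i\<in>T. \<Sum>j\<in>T. (swap_sum T ^^ N) (f x) (transpose i j ` B))"
    by (subst sum.swap[of _ X]) (intro sum.cong refl sum.swap)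
  then show ?case
    by (simp add: swap_sum_def[of T "(swap_sum T ^^ N) g" for g] Suc.IH)
qed simp

lemma swap_sum_power_linear:
  "(swap_sum T ^^ N) (\<lambda>A. c * f A + d * g A) B =
    c * (swap_sum T ^^ N) f B + d * (swap_sum T ^^ N) g B"
  by (induction N arbitrary: B) (simp_all add: swap_sum_def sum.distrib sum_distrib_left)

lemma swap_sum_power_nonneg:
  assumes "\<And>A. 0 \<le> f A"
  shows "0 \<le> (swap_sum T ^^ N) f B"
  using assms by (induction N arbitrary: B) (auto simp: swap_sum_def intro!: sum_nonneg)

text \<open>Summing over the points outside a set commutes with relabelling by a permutation of \<open>T\<close>, and
\<open>swap_sum T\<close> is a sum of such relabellings.\<close>

lemma swap_sum_down_sum: "swap_sum T (down_sum T f) = down_sum T (swap_sum T f)"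
proof
  fix A
  have "down_sum T f (p ` A) = (\<Sum>a\<in>T - A. f (p ` insert a A))" if p: "p permutes T" for p
  proof -
    have "p ` (T - A) = T - p ` A"
      by (simp add: image_set_diff permutes_inj[OF p] permutes_image[OF p])
    moreover have "inj_on p (T - A)"
      using permutes_inj[OF p] by (rule inj_on_subset) simp
    ultimately show ?thesis
      unfolding down_sum_def by (metis (no_types, lifting) image_insert sum.reindex_cong)
  qed
  then have "swap_sum T (down_sum T f) A =
      (\<Sum>i\<in>T. \<Sum>j\<in>T. \<Sum>a\<in>T - A. f (transpose i j ` insert a A))"
    unfolding swap_sum_def by (intro sum.cong refl) (auto simp: transpose_permutes)
  also have "\<dots> = down_sum T (swap_sum T f) A"
    unfolding swap_sum_def down_sum_def
    by (subst sum.swap[of _ "T - A"]) (intro sum.cong refl sum.swap)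
  finally show "swap_sum T (down_sum T f) A = down_sum T (swap_sum T f) A" .
qed

lemma swap_sum_power_down_sum:
  "(swap_sum T ^^ N) (down_sum T f) = down_sum T ((swap_sum T ^^ N) f)"
  by (induction N) (simp_all add: swap_sum_down_sum)

text \<open>A transposition fixes \<open>A\<close> as a set when both points lie on the same side, and otherwise exchanges
one point of \<open>A\<close> for one outside; each exchange arises from two ordered pairs.\<close>

lemma swap_sum_layer:
  assumes T: "finite T" and A: "A \<subseteq> T"
  shows "swap_sum T f A = ((real (card A))\<^sup>2 + (real (card T) - real (card A))\<^sup>2) * f A +
    2 * (\<Sum>a\<in>A. \<Sum>b\<in>T - A. f (insert b (A - {a})))"
proof -
  have fin: "finite A" using T A by (rule rev_finite_subset)
  have split: "(\<Sum>i\<in>T. h i) = (\<Sum>i\<in>A. h i) + (\<Sum>i\<in>T - A. h i)" for h :: "'a \<Rightarrow> real"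
    using T A by (simp add: sum.subset_diff add.commute)
  have swap: "transpose i j ` A = insert j (A - {i})" "transpose j i ` A = insert j (A - {i})"
    if "i \<in> A" "j \<in> T - A" for i j
    using that by (auto simp: transpose_def image_iff)
  have "swap_sum T f A = (\<Sum>i\<in>A. \<Sum>j\<in>A. f A) + (\<Sum>i\<in>A. \<Sum>j\<in>T - A. f (insert j (A - {i}))) +
     ((\<Sum>i\<in>T - A. \<Sum>j\<in>A. f (insert i (A - {j}))) + (\<Sum>i\<in>T - A. \<Sum>j\<in>T - A. f A))"
    unfolding swap_sum_def by (simp add: split sum.distrib swap)
  also have "(\<Sum>i\<in>T - A. \<Sum>j\<in>A. f (insert i (A - {j}))) =
      (\<Sum>a\<in>A. \<Sum>b\<in>T - A. f (insert b (A - {a})))"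
    by (rule sum.swap)
  finally show ?thesis
    using card_mono[OF T A]
    by (simp add: card_Diff_subset[OF fin A] power2_eq_square of_nat_diff algebra_simps)
qed

text \<open>Removing a point and then adding one either restores \<open>A\<close>, in \<open>card A\<close> ways, or performs an exchange.
For \<open>card A = t\<close> the scalar is \<open>\<lambda>\<^sub>t\<close>, the value on functions killed by \<open>down_sum T\<close>.\<close>

lemma swap_sum_up_down:
  assumes T: "finite T" and A: "A \<subseteq> T"
  shows "swap_sum T f A =
    ((real (card A))\<^sup>2 + (real (card T) - real (card A))\<^sup>2 - 2 * real (card A)) * f A +
      2 * up_sum (down_sum T f) A"
proof -
  have "up_sum (down_sum T f) A =
      (\<Sum>a\<in>A. \<Sum>b\<in>insert a (T - A). f (insert b (A - {a})))"
    unfolding up_sum_def down_sum_def using A by (intro sum.cong) auto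
  also have "\<dots> = (\<Sum>a\<in>A. f A + (\<Sum>b\<in>T - A. f (insert b (A - {a}))))"
    using T by (intro sum.cong) (auto simp: insert_absorb)
  finally show ?thesis
    by (simp add: swap_sum_layer[OF assms] sum.distrib algebra_simps)
qed

text \<open>In the opposite order \<open>A\<close> is restored in \<open>card T - card A\<close> ways. For \<open>card A = t - 1\<close> the scalar is again
\<open>\<lambda>\<^sub>t\<close>; this coincidence is what links neighbouring layers.\<close>

lemma swap_sum_down_up:
  assumes T: "finite T" and A: "A \<subseteq> T"
  shows "swap_sum T f A =
    ((real (card A))\<^sup>2 + (real (card T) - real (card A))\<^sup>2 - 2 * (real (card T) - real (card A))) * f A +
      2 * down_sum T (up_sum f) A"
proof -
  have fin: "finite A" using T A by (rule rev_finite_subset)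
  have "down_sum T (up_sum f) A = (\<Sum>b\<in>T - A. f A + (\<Sum>a\<in>A. f (insert b (A - {a}))))"
    unfolding up_sum_def down_sum_def
  proof (intro sum.cong refl)
    fix b assume b: "b \<in> T - A"
    then have "insert b A - {a} = insert b (A - {a})" if "a \<in> A" for a
      using that by auto
    then show "(\<Sum>a\<in>insert b A. f (insert b A - {a})) =
        f A + (\<Sum>a\<in>A. f (insert b (A - {a})))"
      using fin b by simp
  qed
  also have "\<dots> = real (card (T - A)) * f A + (\<Sum>b\<in>T - A. \<Sum>a\<in>A. f (insert b (A - {a})))"
    by (simp add: sum.distrib)
  also have "(\<Sum>b\<in>T - A. \<Sum>a\<in>A. f (insert b (A - {a}))) =
      (\<Sum>a\<in>A. \<Sum>b\<in>T - A. f (insert b (A - {a})))"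
    by (rule sum.swap)
  finally show ?thesis
    using card_mono[OF T A]
    by (simp add: swap_sum_layer[OF assms] card_Diff_subset[OF fin A] of_nat_diff algebra_simps)
qed

definition swap_trace :: "'a set \<Rightarrow> nat \<Rightarrow> nat \<Rightarrow> real"
  where "swap_trace T t N = (\<Sum>A\<in>subsets_of_card T t. (swap_sum T ^^ N) (point_mass A) A)"

text \<open>The scalar in \<open>swap_sum_up_down\<close> for \<open>j\<close>-subsets of an \<open>m\<close>-set: the eigenvalue of \<open>swap_sum\<close> on those functions
of \<open>j\<close>-subsets that \<open>down_sum\<close> kills.\<close>

definition swap_eigenvalue :: "nat \<Rightarrow> nat \<Rightarrow> real"
  where "swap_eigenvalue m j = (real m)\<^sup>2 - 2 * real j * (real m - real j + 1)"

lemma down_sum_point_mass: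
  assumes "finite T" "A \<subseteq> T"
  shows "down_sum T (point_mass A) = (\<lambda>B. \<Sum>a\<in>A. point_mass (A - {a}) B)"
proof
  fix B
  have fin: "finite A" using assms by (metis rev_finite_subset)
  have "down_sum T (point_mass A) B = real (card {a \<in> T - B. insert a B = A})"
    using assms by (simp add: down_sum_def sum.If_cases of_bool_def Int_def)
  also have "{a \<in> T - B. insert a B = A} = {a \<in> A. B = A - {a}}"
    using assms by auto
  also have "real (card \<dots>) = (\<Sum>a\<in>A. point_mass (A - {a}) B)"
    using fin by (simp add: sum.If_cases of_bool_def Int_def)
  finally show "down_sum T (point_mass A) B = (\<Sum>a\<in>A. point_mass (A - {a}) B)" .
qed

text \<open>The identity \<open>tr (L\<^sup>N U D) = tr (D L\<^sup>N U) = tr (L\<^sup>N D U)\<close> for \<open>L = swap_sum T\<close>. The first trace is taken over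
\<open>(t + 1)\<close>-subsets, the others over \<open>t\<close>-subsets; the first equality reindexes the pairs of a set
and one of its points, the second is the commutation of \<open>D\<close> with \<open>L\<close>.\<close>

lemma swap_trace_cyclic:
  assumes T: "finite T"
  shows "(\<Sum>A\<in>subsets_of_card T (Suc t). (swap_sum T ^^ N) (up_sum (down_sum T (point_mass A))) A) =
    (\<Sum>B\<in>subsets_of_card T t. (swap_sum T ^^ N) (down_sum T (up_sum (point_mass B))) B)"
proof -
  let ?F = "\<lambda>B. (swap_sum T ^^ N) (up_sum (point_mass B))"
  have "up_sum (down_sum T (point_mass A)) = (\<lambda>C. \<Sum>a\<in>A. up_sum (point_mass (A - {a})) C)"
    if "A \<in> subsets_of_card T (Suc t)" for A
    using that T
    by (auto simp: subsets_of_card_def down_sum_point_mass up_sum_def fun_eq_iff intro: sum.swap)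
  then have "(\<Sum>A\<in>subsets_of_card T (Suc t).
        (swap_sum T ^^ N) (up_sum (down_sum T (point_mass A))) A) =
      (\<Sum>A\<in>subsets_of_card T (Suc t). \<Sum>a\<in>A. ?F (A - {a}) A)"
    by (simp add: swap_sum_power_sum)
  also have "\<dots> = (\<Sum>(A, a)\<in>Sigma (subsets_of_card T (Suc t)) (\<lambda>A. A). ?F (A - {a}) A)"
    using T by (subst sum.Sigma) (auto simp: subsets_of_card_def dest: rev_finite_subset)
  also have "\<dots> = (\<Sum>(B, a)\<in>Sigma (subsets_of_card T t) (\<lambda>B. T - B). ?F B (insert a B))"
    by (rule sum.reindex_bij_witness[of _ "\<lambda>(B, a). (insert a B, a)" "\<lambda>(A, a). (A - {a}, a)"])
      (use T in \<open>auto simp: subsets_of_card_def insert_absorb card_insert_if rev_finite_subset\<close>)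
  also have "\<dots> = (\<Sum>B\<in>subsets_of_card T t. down_sum T (?F B) B)"
    unfolding down_sum_def using T by (subst sum.Sigma) auto
  finally show ?thesis
    by (simp add: swap_sum_power_down_sum)
qed

text \<open>By \<open>swap_sum_up_down\<close> and \<open>swap_sum_down_up\<close> one factor of the power can be replaced by the scalar
\<open>swap_eigenvalue (card T) (Suc t)\<close> plus twice \<open>U D\<close> or \<open>D U\<close>. The contributions of the latter cancel by cyclicity, so
that the difference of the two traces is multiplied by this scalar whenever \<open>N\<close> increases; at \<open>N = 0\<close> it is the
difference of the dimensions.\<close>

lemma swap_trace_Suc_diff:
  assumes T: "finite T"
  shows "swap_trace T (Suc t) N - swap_trace T t N =
    swap_eigenvalue (card T) (Suc t) ^ N *
      (real (card T choose Suc t) - real (card T choose t))"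
proof (induction N)
  case 0
  show ?case
    by (simp add: swap_trace_def card_subsets_of_card T)
next
  case (Suc N)
  let ?e = "swap_eigenvalue (card T) (Suc t)"
  have "swap_trace T (Suc t) (Suc N) = (\<Sum>A\<in>subsets_of_card T (Suc t).
      (swap_sum T ^^ N) (\<lambda>B. ?e * point_mass A B + 2 * up_sum (down_sum T (point_mass A)) B) A)"
    unfolding swap_trace_def funpow_Suc_right o_apply
  proof (intro sum.cong refl swap_sum_power_cong[of T "Suc t"])
    fix A B assume "B \<in> subsets_of_card T (Suc t)"
    then show "swap_sum T (point_mass A) B =
        ?e * point_mass A B + 2 * up_sum (down_sum T (point_mass A)) B"
      using T by (subst swap_sum_up_down)
        (auto simp: subsets_of_card_def swap_eigenvalue_def power2_eq_square algebra_simps)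
  qed
  moreover have "swap_trace T t (Suc N) = (\<Sum>A\<in>subsets_of_card T t.
      (swap_sum T ^^ N) (\<lambda>B. ?e * point_mass A B + 2 * down_sum T (up_sum (point_mass A)) B) A)"
    unfolding swap_trace_def funpow_Suc_right o_apply
  proof (intro sum.cong refl swap_sum_power_cong[of T t])
    fix A B assume "B \<in> subsets_of_card T t"
    then show "swap_sum T (point_mass A) B =
        ?e * point_mass A B + 2 * down_sum T (up_sum (point_mass A)) B"
      using T by (subst swap_sum_down_up)
        (auto simp: subsets_of_card_def swap_eigenvalue_def power2_eq_square algebra_simps)
  qed
  ultimately have "swap_trace T (Suc t) (Suc N) - swap_trace T t (Suc N) =
      ?e * (swap_trace T (Suc t) N - swap_trace T t N)"
    by (simp add: swap_sum_power_linear sum.distrib sum_distrib_left[symmetric]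
        swap_trace_cyclic[OF T] swap_trace_def right_diff_distrib)
  then show ?case
    using Suc.IH by simp
qed

lemma swap_trace_0: "finite T \<Longrightarrow> swap_trace T 0 N = (real (card T))\<^sup>2 ^ N"
proof -
  assume T: "finite T"
  have "(swap_sum T ^^ N) (point_mass {}) {} = (real (card T))\<^sup>2 ^ N"
    by (induction N) (simp_all add: swap_sum_def power2_eq_square)
  moreover have "subsets_of_card T 0 = {{}}"
    using T by (auto simp: subsets_of_card_def dest: rev_finite_subset)
  ultimately show ?thesis
    by (simp add: swap_trace_def)
qed

text \<open>The traces telescope. Beyond the middle layer the binomial coefficients no longer increase, and because the
power is even these increments are not positive; below the middle the subtracted coefficient is
dropped. The bound is therefore uniform in \<open>t\<close>.\<close>

lemma swap_trace_even_le:
  assumes T: "finite T" and "even N"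
  shows "swap_trace T t N \<le>
    (\<Sum>j | 2 * j \<le> card T. real (card T choose j) * swap_eigenvalue (card T) j ^ N)"
proof -
  let ?m = "card T"
  define h where "h j = real (?m choose j) * swap_eigenvalue ?m j ^ N" for j
  have h: "0 \<le> h j" for j
    using \<open>even N\<close> by (simp add: h_def zero_le_even_power)
  have "swap_trace T t N \<le> (\<Sum>j | j \<le> t \<and> 2 * j \<le> ?m. h j)"
  proof (induction t)
    case 0
    have "{j::nat. j \<le> 0 \<and> 2 * j \<le> ?m} = {0}" by auto
    then show ?case
      using swap_trace_0[OF T] by (simp add: h_def swap_eigenvalue_def)
  next
    case (Suc t)
    let ?d = "swap_eigenvalue ?m (Suc t) ^ N * (real (?m choose Suc t) - real (?m choose t))"
    have pos: "0 \<le> swap_eigenvalue ?m (Suc t) ^ N"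
      using \<open>even N\<close> by (rule zero_le_even_power)
    have "?d \<le> (\<Sum>j | j \<in> {Suc t} \<and> 2 * j \<le> ?m. h j)"
    proof (cases "2 * Suc t \<le> ?m")
      case True
      then have "{j. j \<in> {Suc t} \<and> 2 * j \<le> ?m} = {Suc t}" by auto
      then show ?thesis using pos by (simp add: h_def algebra_simps)
    next
      case False
      then have eq: "{j. j \<in> {Suc t} \<and> 2 * j \<le> ?m} = {}" by auto
      have "?m choose Suc t \<le> ?m choose t"
        using False by (cases "Suc t \<le> ?m") (auto intro!: binomial_antimono simp: binomial_eq_0)
      then show ?thesis unfolding eq using pos by (simp add: mult_nonneg_nonpos)
    qed
    moreover have "(\<Sum>j | j \<le> Suc t \<and> 2 * j \<le> ?m. h j) =
        (\<Sum>j | j \<le> t \<and> 2 * j \<le> ?m. h j) + (\<Sum>j | j \<in> {Suc t} \<and> 2 * j \<le> ?m. h j)"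
      by (subst sum.union_disjoint[symmetric]) (auto intro!: sum.cong)
    ultimately show ?case
      using Suc.IH swap_trace_Suc_diff[OF T, of t N] by linarith
  qed
  also have "\<dots> \<le> (\<Sum>j | 2 * j \<le> ?m. h j)"
  proof (rule sum_mono2)
    show "finite {j. 2 * j \<le> ?m}" by (rule finite_subset[of _ "{..?m}"]) auto
  qed (use h in auto)
  finally show ?thesis by (simp add: h_def)
qed


section \<open>Diagonal entries for all sets of untouched positions\<close>

lemma ex_permutes_image:
  assumes V: "finite V" and "A \<in> subsets_of_card V t" "B \<in> subsets_of_card V t"
  obtains p where "p permutes V" "p ` A = B"
proof -
  have AB: "A \<subseteq> V" "B \<subseteq> V" "card A = card B" "finite A" "finite B"
    using assms finite_subset[OF _ V] by (simp_all add: subsets_of_card_def)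
  obtain f where f: "bij_betw f A B"
    using finite_same_card_bij[OF AB(4,5,3)] by blast
  have "card (V - A) = card (V - B)"
    using V AB by (simp add: card_Diff_subset)
  then obtain g where g: "bij_betw g (V - A) (V - B)"
    using finite_same_card_bij[of "V - A" "V - B"] V by blast
  define p where "p x = (if x \<in> A then f x else if x \<in> V then g x else x)" for x
  have pA: "bij_betw p A B"
    using f by (subst bij_betw_cong[of A p f]) (simp_all add: p_def)
  moreover have "bij_betw p (V - A) (V - B)"
    using g by (subst bij_betw_cong[of "V - A" p g]) (simp_all add: p_def)
  ultimately have "bij_betw p (A \<union> (V - A)) (B \<union> (V - B))"
    by (rule bij_betw_combine) auto
  then have "bij_betw p V V"
    by (simp only: Un_Diff_cancel Un_absorb1 AB)
  then have "p permutes V"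
    by (rule bij_imp_permutes) (use \<open>A \<subseteq> V\<close> in \<open>auto simp: p_def\<close>)
  then show ?thesis
    by (rule that) (use pA in \<open>simp add: bij_betw_def\<close>)
qed

lemma sum_subsets_of_card_permutes:
  assumes p: "p permutes V"
  shows "(\<Sum>A\<in>subsets_of_card V t. f (p ` A)) = (\<Sum>A\<in>subsets_of_card V t. f A)"
proof (rule sum.reindex_bij_witness[of _ "image (inv' p)" "image p"])
  show "p ` (inv' p ` B) = B" "inv' p ` (p ` B) = B" for B
    by (simp_all add: image_comp permutes_inv_o[OF p])
qed (use p permutes_inv[OF p] in \<open>auto intro: permutes_image_subsets_of_card\<close>)

lemma swap_sum_adjoint:
  assumes "T \<subseteq> V"
  shows "(\<Sum>A\<in>subsets_of_card V t. swap_sum T f A * g A) =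
    (\<Sum>A\<in>subsets_of_card V t. f A * swap_sum T g A)"
proof -
  let ?\<Omega> = "subsets_of_card V t"
  have eq: "(\<Sum>A\<in>?\<Omega>. f (transpose i j ` A) * g A) = (\<Sum>A\<in>?\<Omega>. f A * g (transpose i j ` A))"
    if "i \<in> T" "j \<in> T" for i j
  proof -
    have "transpose i j permutes V"
      using that assms by (auto intro: transpose_permutes)
    from sum_subsets_of_card_permutes[OF this, of "\<lambda>A. f A * g (transpose i j ` A)" t]
    show ?thesis by (simp add: image_comp)
  qed
  have "(\<Sum>A\<in>?\<Omega>. swap_sum T f A * g A) =
      (\<Sum>i\<in>T. \<Sum>j\<in>T. \<Sum>A\<in>?\<Omega>. f (transpose i j ` A) * g A)"
    unfolding swap_sum_def sum_distrib_right
    by (subst sum.swap) (intro sum.cong refl sum.swap)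
  also have "\<dots> = (\<Sum>i\<in>T. \<Sum>j\<in>T. \<Sum>A\<in>?\<Omega>. f A * g (transpose i j ` A))"
    by (intro sum.cong[of T, OF refl] eq)
  also have "\<dots> = (\<Sum>A\<in>?\<Omega>. f A * swap_sum T g A)"
    unfolding swap_sum_def sum_distrib_left
    by (subst (2) sum.swap) (intro sum.cong refl sum.swap)
  finally show ?thesis .
qed

lemma swap_sum_power_adjoint:
  assumes "T \<subseteq> V"
  shows "(\<Sum>A\<in>subsets_of_card V t. (swap_sum T ^^ k) f A * g A) =
    (\<Sum>A\<in>subsets_of_card V t. f A * (swap_sum T ^^ k) g A)"
proof (induction k arbitrary: g)
  case (Suc k)
  have "(swap_sum T ^^ Suc k) g = (swap_sum T ^^ k) (swap_sum T g)"
    by (simp add: funpow_swap1)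
  then show ?case
    using Suc.IH[of "swap_sum T g"] by (simp add: swap_sum_adjoint[OF assms])
qed simp

text \<open>The operator is self-adjoint, so the squared norm of \<open>L\<^sup>k \<delta>\<^sub>R\<close> is the return weight \<open>\<langle>\<delta>\<^sub>R, L\<^sup>2\<^sup>k \<delta>\<^sub>R\<rangle>\<close>.\<close>

lemma sum_swap_sum_power_squared:
  assumes "finite V" "T \<subseteq> V" and R: "R \<in> subsets_of_card V t"
  shows "(\<Sum>A\<in>subsets_of_card V t. ((swap_sum T ^^ k) (point_mass R) A)\<^sup>2) =
    (swap_sum T ^^ (2 * k)) (point_mass R) R"
proof -
  let ?f = "(swap_sum T ^^ k) (point_mass R)"
  have "(\<Sum>A\<in>subsets_of_card V t. (?f A)\<^sup>2) =
      (\<Sum>A\<in>subsets_of_card V t. point_mass R A * (swap_sum T ^^ k) ?f A)"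
    using swap_sum_power_adjoint[OF \<open>T \<subseteq> V\<close>, of k "point_mass R" ?f t]
    by (simp only: power2_eq_square)
  also have "\<dots> = (\<Sum>A\<in>subsets_of_card V t. if A = R then (swap_sum T ^^ k) ?f A else 0)"
    by (rule sum.cong[OF refl]) simp
  also have "\<dots> = (swap_sum T ^^ k) ?f R"
    using assms by (simp only: sum.delta finite_subsets_of_card if_True)
  finally show ?thesis
    unfolding mult_2 funpow_add o_apply .
qed

lemma transpose_image_permutes:
  assumes p: "p permutes V"
  shows "transpose (p i) (p j) ` p ` A = p ` transpose i j ` A"
proof -
  have "transpose (p i) (p j) \<circ> p = p \<circ> transpose i j"
    by (simp add: transpose_comp_eq[OF permutes_bij[OF p]] permutes_inverses[OF p])
  then show ?thesis
    unfolding image_comp by (rule arg_cong)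
qed

lemma swap_sum_power_permutes:
  assumes p: "p permutes V"
  shows "(swap_sum (p ` T) ^^ N) f (p ` A) = (swap_sum T ^^ N) (\<lambda>B. f (p ` B)) A"
proof (induction N arbitrary: A)
  case (Suc N)
  let ?F = "(swap_sum (p ` T) ^^ N) f"
  have inj: "inj_on p T"
    by (rule inj_on_subset[OF permutes_inj[OF p] subset_UNIV])
  have "swap_sum (p ` T) ?F (p ` A) =
      (\<Sum>i\<in>T. \<Sum>j\<in>T. ?F (transpose (p i) (p j) ` p ` A))"
    unfolding swap_sum_def[of _ ?F] by (simp add: sum.reindex[OF inj])
  also have "\<dots> = swap_sum T ((swap_sum T ^^ N) (\<lambda>B. f (p ` B))) A"
    unfolding transpose_image_permutes[OF p] Suc.IH by (rule swap_sum_def[symmetric])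
  finally show ?case
    by simp
qed simp

lemma swap_sum_power_diagonal_permutes:
  assumes p: "p permutes V"
  shows "(swap_sum (p ` T) ^^ N) (point_mass (p ` A)) (p ` A) = (swap_sum T ^^ N) (point_mass A) A"
  using swap_sum_power_permutes[OF p, of N T "point_mass (p ` A)" A]
  by (simp add: inj_image_eq_iff permutes_inj[OF p])

text \<open>A permutation that maps \<open>R\<close> to \<open>A\<close> carries the diagonal entry at \<open>R\<close> for \<open>T\<close> to the one at \<open>A\<close> for the
image of \<open>T\<close>. Summed over all \<open>T\<close> the entry is therefore the same for all \<open>R\<close> and equals its average.\<close>

lemma sum_swap_sum_power_diagonal:
  assumes V: "finite V" and R: "R \<in> subsets_of_card V t"
  shows "real (card V choose t) * (\<Sum>T\<in>Pow V. (swap_sum T ^^ N) (point_mass R) R) =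
    (\<Sum>T\<in>Pow V. \<Sum>A\<in>subsets_of_card V t. (swap_sum T ^^ N) (point_mass A) A)"
proof -
  have "(\<Sum>T\<in>Pow V. (swap_sum T ^^ N) (point_mass A) A) =
      (\<Sum>T\<in>Pow V. (swap_sum T ^^ N) (point_mass R) R)"
    if A: "A \<in> subsets_of_card V t" for A
  proof -
    obtain p where p: "p permutes V" "p ` R = A"
      by (rule ex_permutes_image[OF V R A])
    have inj: "inj_on (image p) (Pow V)"
      using permutes_inj_on[OF p(1)] by (rule inj_on_image_Pow)
    have "image p ` Pow V = Pow V"
      using permutes_image[OF p(1)] by (simp add: image_Pow_surj)
    with inj have "(\<Sum>T\<in>Pow V. (swap_sum T ^^ N) (point_mass A) A) =
        (\<Sum>T\<in>Pow V. (swap_sum (p ` T) ^^ N) (point_mass (p ` R)) (p ` R))"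
      unfolding p(2) by (metis (no_types, lifting) sum.reindex_cong)
    then show ?thesis
      by (simp add: swap_sum_power_diagonal_permutes[OF p(1)])
  qed
  then show ?thesis
    by (subst sum.swap) (simp add: card_subsets_of_card V)
qed

text \<open>The transpositions of points of \<open>T\<close> never move the part of a set outside \<open>T\<close>.\<close>

lemma swap_sum_power_diagonal_Int:
  "(swap_sum T ^^ N) (point_mass A) A = (swap_sum T ^^ N) (point_mass (A \<inter> T)) (A \<inter> T)"
proof -
  have "(swap_sum T ^^ N) (point_mass A) B = (swap_sum T ^^ N) (point_mass (A \<inter> T)) (B \<inter> T)"
    if "B - T = A - T" for B
    using that
  proof (induction N arbitrary: B)
    case 0
    then show ?case by (auto simp: of_bool_def)
  next
    case (Suc N)
    have "p ` B - T = A - T" "p ` B \<inter> T = p ` (B \<inter> T)" if "p permutes T" for p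
    proof -
      have "p ` (B - T) = id ` (B - T)"
        using permutes_not_in[OF that] by (intro image_cong refl) simp
      moreover have "p ` B - T = p ` (B - T)"
        using permutes_in_image[OF that] by blast
      ultimately show "p ` B - T = A - T"
        using Suc.prems by simp
      show "p ` B \<inter> T = p ` (B \<inter> T)"
        using permutes_in_image[OF that] by blast
    qed
    note inv = this[OF transpose_permutes]
    show ?case
      unfolding funpow.simps o_apply swap_sum_def[of T "(swap_sum T ^^ N) g" for g]
      by (intro sum.cong refl) (simp only: Suc.IH inv)
  qed
  then show ?thesis by simp
qed

text \<open>The sets \<open>A\<close> are grouped by their part \<open>B\<close> outside \<open>T\<close>, for which there are at most \<open>2 ^ card (V - T)\<close>
choices; each group is part of a trace over the \<open>(t - card B)\<close>-subsets of \<open>T\<close>.\<close>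

lemma sum_swap_sum_power_diagonal_le:
  assumes V: "finite V" and T: "T \<subseteq> V" and "even N"
  shows "(\<Sum>A\<in>subsets_of_card V t. (swap_sum T ^^ N) (point_mass A) A) \<le>
    2 ^ card (V - T) *
      (\<Sum>j | 2 * j \<le> card T. real (card T choose j) * swap_eigenvalue (card T) j ^ N)"
    (is "_ \<le> _ * ?B")
proof -
  let ?\<Omega> = "subsets_of_card V t"
  let ?d = "\<lambda>A. (swap_sum T ^^ N) (point_mass A) A"
  have fin: "finite T" using V T by (rule rev_finite_subset)
  have "(\<Sum>A\<in>?\<Omega>. ?d A) = (\<Sum>B\<in>Pow (V - T). \<Sum>A | A \<in> ?\<Omega> \<and> A - T = B. ?d A)"
    by (rule sum.group[symmetric]) (use V in \<open>auto simp: subsets_of_card_def\<close>)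
  also have "\<dots> \<le> (\<Sum>B\<in>Pow (V - T). ?B)"
  proof (rule sum_mono)
    fix B assume B: "B \<in> Pow (V - T)"
    have inj: "inj_on (\<lambda>A. A \<inter> T) {A \<in> ?\<Omega>. A - T = B}"
      by (rule inj_onI) blast
    have "(\<Sum>A | A \<in> ?\<Omega> \<and> A - T = B. ?d A) = (\<Sum>A\<in>(\<lambda>A. A \<inter> T) ` {A \<in> ?\<Omega>. A - T = B}. ?d A)"
      by (simp only: sum.reindex[OF inj] o_def swap_sum_power_diagonal_Int[symmetric])
    also have "\<dots> \<le> swap_trace T (t - card B) N"
      unfolding swap_trace_def
    proof (rule sum_mono2)
      show "(\<lambda>A. A \<inter> T) ` {A \<in> ?\<Omega>. A - T = B} \<subseteq> subsets_of_card T (t - card B)"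
      proof clarsimp
        fix A assume A: "A \<in> ?\<Omega>" "B = A - T"
        then have "finite A" using finite_subset[OF _ V] by (simp add: subsets_of_card_def)
        then have "card A = card (A \<inter> T) + card (A - T)"
          by (rule card_Int_Diff)
        then show "A \<inter> T \<in> subsets_of_card T (t - card (A - T))"
          using A by (auto simp: subsets_of_card_def)
      qed
    qed (use fin in \<open>auto intro: swap_sum_power_nonneg\<close>)
    also have "\<dots> \<le> ?B"
      by (rule swap_trace_even_le) fact+
    finally show "(\<Sum>A | A \<in> ?\<Omega> \<and> A - T = B. ?d A) \<le> ?B" .
  qed
  also have "\<dots> = 2 ^ card (V - T) * ?B"
    using V by (simp add: card_Pow)
  finally show ?thesis .
qed


section \<open>Estimating the sum of eigenvalue powers\<close>

text \<open>The normalised contribution of the \<open>j\<close>-th eigenvalue to the trace, \<open>j \<ge> 1\<close>, turns out to be at most \<open>exp (- c)\<close>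
times this number, whatever the size of \<open>T\<close>.\<close>

definition tail_term :: "nat \<Rightarrow> real"
  where "tail_term j = (2 * real j) powr ((real j - 1) / 2) / fact j"

lemma tail_term_nonneg: "0 \<le> tail_term j"
  by (simp add: tail_term_def)

text \<open>The quotient of consecutive terms is at most \<open>3 sqrt (2 (j + 1)) / (j + 1)\<close>, which is at most \<open>1 / 2\<close> as soon as
\<open>j + 1 \<ge> 72\<close>.\<close>

lemma summable_tail_term: "summable tail_term"
proof (rule summable_ratio_test[of "1/2" 72])
  fix j :: nat assume j: "72 \<le> j"
  let ?a = "(2 * real j) powr ((real j - 1) / 2)" and ?s = "sqrt (2 * real (Suc j))"
  have "(2 * real (Suc j)) powr ((real (Suc j) - 1) / 2) =
      (2 * real (Suc j)) powr ((real j - 1) / 2 + 1 / 2)"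
    by (simp add: field_simps)
  also have "\<dots> = (2 * real (Suc j)) powr ((real j - 1) / 2) * ?s"
    by (simp only: powr_add powr_half_sqrt of_nat_0_le_iff mult_nonneg_nonneg zero_le_numeral)
  also have "(2 * real (Suc j)) powr ((real j - 1) / 2) = ?a * (1 + 1 / j) powr ((real j - 1) / 2)"
  proof -
    have "2 * real (Suc j) = 2 * real j * (1 + 1 / j)"
      using j by (simp add: field_simps)
    then show ?thesis
      by (simp only: powr_mult)
  qed
  finally have 1: "(2 * real (Suc j)) powr ((real (Suc j) - 1) / 2) =
      ?a * ((1 + 1 / j) powr ((real j - 1) / 2) * ?s)"
    by (simp only: mult.assoc)
  have "(1 + 1 / j) powr ((real j - 1) / 2) \<le> exp (1 / j) powr ((real j - 1) / 2)"
    using j by (intro powr_mono2) (auto simp: exp_ge_add_one_self)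
  also have "\<dots> = exp (1 / j * ((real j - 1) / 2))"
    by (simp add: exp_powr_real)
  also have "\<dots> \<le> exp 1"
    using j by (simp add: field_simps)
  also have "\<dots> \<le> 3" by (rule exp_le)
  finally have "(1 + 1 / j) powr ((real j - 1) / 2) * ?s \<le> 3 * ?s"
    by (rule mult_right_mono) simp
  also have "\<dots> \<le> real (Suc j) / 2"
  proof -
    have "?s \<le> real (Suc j) / 6"
      using j mult_right_mono[of 72 "real (Suc j)" "real (Suc j)"]
      by (intro real_le_lsqrt) (simp_all add: power2_eq_square)
    then show ?thesis by simp
  qed
  finally have "(2 * real (Suc j)) powr ((real (Suc j) - 1) / 2) \<le> ?a * (real (Suc j) / 2)"
    unfolding 1 by (rule mult_left_mono) simp
  then have "tail_term (Suc j) \<le> ?a * (real (Suc j) / 2) / fact (Suc j)"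
    unfolding tail_term_def by (rule divide_right_mono) simp
  also have "\<dots> = 1 / 2 * tail_term j"
    unfolding tail_term_def fact_Suc by (simp del: of_nat_Suc)
  finally show "norm (tail_term (Suc j)) \<le> 1 / 2 * norm (tail_term j)"
    by (simp add: tail_term_nonneg)
qed simp

text \<open>Two monotonicity facts carry the estimate. The exponent \<open>q = j (m - j + 1) / m\<close> is at least \<open>1\<close>, which
yields the factor \<open>exp (- c)\<close>. With the bound \<open>m ^ j / j!\<close> for the binomial coefficient, what remains is
\<open>exp (j (j - 1) ln m / m) / j!\<close>; since \<open>ln x / x\<close> decreases for \<open>x \<ge> exp 1\<close>, its maximum over \<open>m \<ge> 2 j\<close>
is attained at \<open>m = 2 j\<close>.\<close>

lemma binomial_exp_le_tail_term:
  fixes c :: real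
  assumes j: "1 \<le> j" "2 * j \<le> m" and c: "0 \<le> c"
  shows "real (m choose j) * exp (- (ln m + c) * (real j * (real m - real j + 1) / real m)) \<le>
    tail_term j * exp (- c)"
proof -
  let ?q = "real j * (real m - real j + 1) / real m"
  have m: "0 < real m" using j by simp
  have "real (m choose j) * fact j \<le> real m ^ j"
    using binomial_fact_pow[of m j] by (metis of_nat_fact of_nat_le_iff of_nat_mult of_nat_power)
  then have C: "real (m choose j) \<le> exp (real j * ln m) / fact j"
    using m by (simp add: field_simps exp_of_nat_mult)
  \<comment> \<open>a rearrangement of \<open>(j - 1) (m - j) \<ge> 0\<close>\<close>
  have "m + j * j \<le> j * m + j"
  proof -
    have "0 \<le> (int j - 1) * (int m - int j)" using j by simp
    then have "int (m + j * j) \<le> int (j * m + j)" by (simp add: algebra_simps)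
    then show ?thesis by linarith
  qed
  then have "real (m + j * j) \<le> real (j * m + j)" by (rule of_nat_mono)
  then have "1 \<le> ?q" using m by (simp add: field_simps)
  then have 1: "exp (- (c * ?q)) \<le> exp (- c)"
    using c mult_left_mono[of 1 ?q c] by simp
  have "real j * ln m - ln m * ?q = ln m / m * (real j * (real j - 1))"
    using m by (simp add: field_simps)
  also have "\<dots> \<le> ln (2 * real j) / (2 * real j) * (real j * (real j - 1))"
  proof (cases "j = 1")
    case False
    \<comment> \<open>the logarithmic quotient is only monotone from \<open>exp 1\<close> on; for \<open>j = 1\<close> the factor \<open>j - 1\<close> vanishes\<close>
    then have "exp 1 \<le> 2 * real j" using exp_le j by linarith
    then have "ln m / m \<le> ln (2 * real j) / (2 * real j)"
      using j by (intro ln_x_over_x_mono) auto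
    then show ?thesis using j by (intro mult_right_mono) auto
  qed simp
  also have "\<dots> = (real j - 1) / 2 * ln (2 * real j)"
    using j by (simp add: field_simps)
  finally have "exp (real j * ln m - ln m * ?q) \<le> (2 * real j) powr ((real j - 1) / 2)"
    using j by (simp add: powr_def)
  then have 2: "exp (real j * ln m - ln m * ?q) / fact j \<le> tail_term j"
    unfolding tail_term_def by (rule divide_right_mono) simp
  have exp: "exp (- (ln m + c) * ?q) = exp (- (ln m * ?q)) * exp (- (c * ?q))"
    by (simp only: exp_add[symmetric] minus_add_distrib distrib_right mult_minus_left)
  have "real (m choose j) * (exp (- (ln m * ?q)) * exp (- (c * ?q))) \<le>
      exp (real j * ln m) / fact j * (exp (- (ln m * ?q)) * exp (- (c * ?q)))"
    using C by (rule mult_right_mono) simp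
  also have "exp (real j * ln m) / fact j * (exp (- (ln m * ?q)) * exp (- (c * ?q))) =
      exp (real j * ln m - ln m * ?q) / fact j * exp (- (c * ?q))"
    unfolding exp_diff exp_minus by (simp only: divide_inverse mult_ac)
  also have "\<dots> \<le> tail_term j * exp (- c)"
    using 1 2 by (intro mult_mono) (auto simp: tail_term_nonneg)
  finally show ?thesis
    unfolding exp .
qed

lemma swap_eigenvalue_bounds:
  assumes j: "1 \<le> j" "2 * j \<le> m"
  shows "0 \<le> swap_eigenvalue m j"
    and "swap_eigenvalue m j \<le> (real m)\<^sup>2 * exp (- 2 * (real j * (real m - real j + 1) / (real m)\<^sup>2))"
proof -
  \<comment> \<open>this form shows that no eigenvalue is negative, so that \<open>1 + x \<le> exp x\<close> may be raised to a power\<close>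
  have "swap_eigenvalue m j = (real j - 1)\<^sup>2 + ((real m - real j)\<^sup>2 - 1)"
    by (simp add: swap_eigenvalue_def power2_eq_square algebra_simps)
  moreover have "1 \<le> (real m - real j)\<^sup>2"
    using j by (intro one_le_power) simp
  ultimately show "0 \<le> swap_eigenvalue m j" by simp
  let ?x = "- 2 * (real j * (real m - real j + 1) / (real m)\<^sup>2)"
  have "swap_eigenvalue m j = (real m)\<^sup>2 * (1 + ?x)"
    using j by (simp add: swap_eigenvalue_def field_simps)
  also have "\<dots> \<le> (real m)\<^sup>2 * exp ?x"
    by (intro mult_left_mono exp_ge_add_one_self) simp
  finally show "swap_eigenvalue m j \<le> (real m)\<^sup>2 * exp ?x" .
qed

text \<open>For \<open>m = card T\<close>, the eigenvalue \<open>j = 0\<close> contributes \<open>m ^ (4 * k) \<le> n ^ (4 * k) exp (- 4 k (n - m) / n)\<close>, and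
the choice of \<open>k\<close> makes the exponential equal to \<open>(exp (- c) / n) ^ (n - m)\<close>. All other eigenvalues are
compared with this one by means of \<open>binomial_exp_le_tail_term\<close>, which applies because \<open>4 k / m \<ge> ln m + c\<close>.
The hypothesis \<open>0 < k\<close> matters for \<open>m = 0\<close>, where the only eigenvalue is \<open>0\<close>.\<close>

lemma layer_sum_le:
  fixes c :: real
  assumes m: "m \<le> n" and n: "0 < n" and k: "0 < k" "4 * real k = real n * (ln n + c)"
    and c: "0 \<le> c"
  shows "(\<Sum>j | 2 * j \<le> m. real (m choose j) * swap_eigenvalue m j ^ (2 * k)) \<le>
    real n ^ (4 * k) * (exp (- c) / n) ^ (n - m) * (1 + suminf tail_term * exp (- c))"
    (is "?L \<le> _ * (1 + ?A * _)")
proof -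
  let ?l = "ln n + c"
  have l: "0 \<le> ?l" using n c by simp
  have A: "0 \<le> ?A" using suminf_nonneg summable_tail_term tail_term_nonneg by blast
  show ?thesis
  proof (cases "m = 0")
    case True
    then have "?L = 0" using k by (simp add: swap_eigenvalue_def)
    then show ?thesis using A by (simp add: add_nonneg_nonneg)
  next
    case False
    have fin: "finite {j. j \<noteq> 0 \<and> 2 * j \<le> m}"
      by (rule finite_subset[of _ "{..m}"]) auto
    have tail: "real (m choose j) * swap_eigenvalue m j ^ (2 * k) \<le>
        real m ^ (4 * k) * (tail_term j * exp (- c))" if j: "1 \<le> j" "2 * j \<le> m" for j
    proof -
      let ?q = "real j * (real m - real j + 1)"
      have q: "0 \<le> ?q" using j by simp
      have "swap_eigenvalue m j ^ (2 * k) \<le> ((real m)\<^sup>2 * exp (- 2 * (?q / (real m)\<^sup>2))) ^ (2 * k)"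
        using swap_eigenvalue_bounds[OF j] by (intro power_mono) auto
      also have "\<dots> = real m ^ (4 * k) * exp (- (4 * real k) * (?q / (real m)\<^sup>2))"
        unfolding power_mult_distrib
        by (simp add: exp_of_nat_mult[symmetric] power_mult[symmetric] algebra_simps)
      also have "exp (- (4 * real k) * (?q / (real m)\<^sup>2)) \<le> exp (- (ln m + c) * (?q / m))"
      proof -
        have "(ln m + c) * (?q / m) \<le> (n / m * ?l) * (?q / m)"
        proof (rule mult_right_mono)
          have "ln m + c \<le> 1 * ?l" using m False by simp
          also have "\<dots> \<le> n / m * ?l"
            using m False l by (intro mult_right_mono) auto
          finally show "ln m + c \<le> n / m * ?l" .
        qed (use q in simp)
        also have "\<dots> = (4 * real k) * (?q / (real m)\<^sup>2)"
          unfolding k by (simp add: power2_eq_square)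
        finally show ?thesis
          by (simp only: mult_minus_left exp_le_cancel_iff neg_le_iff_le)
      qed
      finally have "swap_eigenvalue m j ^ (2 * k) \<le> real m ^ (4 * k) * exp (- (ln m + c) * (?q / m))"
        by (simp add: mult_left_mono)
      then have "real (m choose j) * swap_eigenvalue m j ^ (2 * k) \<le>
          real (m choose j) * (real m ^ (4 * k) * exp (- (ln m + c) * (?q / m)))"
        by (rule mult_left_mono) simp
      also have "\<dots> = real m ^ (4 * k) * (real (m choose j) * exp (- (ln m + c) * (?q / m)))"
        by (simp only: mult_ac)
      also have "\<dots> \<le> real m ^ (4 * k) * (tail_term j * exp (- c))"
        using binomial_exp_le_tail_term[OF j c] by (rule mult_left_mono) simp
      finally show ?thesis .
    qed
    have "{j. 2 * j \<le> m} = insert 0 {j. j \<noteq> 0 \<and> 2 * j \<le> m}"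
      by auto
    then have "?L = real m ^ (4 * k) +
        (\<Sum>j | j \<noteq> 0 \<and> 2 * j \<le> m. real (m choose j) * swap_eigenvalue m j ^ (2 * k))"
      using fin by (simp add: swap_eigenvalue_def power_mult[symmetric])
    also have "\<dots> \<le> real m ^ (4 * k) +
        (\<Sum>j | j \<noteq> 0 \<and> 2 * j \<le> m. real m ^ (4 * k) * (tail_term j * exp (- c)))"
      using tail by (intro add_left_mono sum_mono) auto
    also have "\<dots> = real m ^ (4 * k) * (1 + (\<Sum>j | j \<noteq> 0 \<and> 2 * j \<le> m. tail_term j) * exp (- c))"
      by (simp add: sum_distrib_left sum_distrib_right algebra_simps)
    also have "\<dots> \<le> real m ^ (4 * k) * (1 + ?A * exp (- c))"
      using sum_le_suminf[OF summable_tail_term fin] tail_term_nonneg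
      by (intro mult_left_mono add_left_mono mult_right_mono) auto
    also have "real m ^ (4 * k) \<le> real n ^ (4 * k) * (exp (- c) / n) ^ (n - m)"
    proof -
      have "real m = n * (1 + - (real (n - m) / n))"
        using m n by (simp add: field_simps of_nat_diff)
      also have "\<dots> \<le> n * exp (- (real (n - m) / n))"
        by (intro mult_left_mono exp_ge_add_one_self) simp
      finally have "real m ^ (4 * k) \<le> (n * exp (- (real (n - m) / n))) ^ (4 * k)"
        by (rule power_mono) simp
      also have "\<dots> = real n ^ (4 * k) * exp (- (4 * real k) * (real (n - m) / n))"
        unfolding power_mult_distrib by (simp add: exp_of_nat_mult[symmetric] algebra_simps)
      also have "- (4 * real k) * (real (n - m) / n) = real (n - m) * (- c - ln n)"
        unfolding k using n by (simp add: field_simps)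
      also have "exp \<dots> = (exp (- c) / n) ^ (n - m)"
        using n by (simp add: exp_of_nat_mult exp_diff)
      finally show ?thesis .
    qed
    finally show ?thesis
      using A by (simp add: mult_right_mono add_nonneg_nonneg)
  qed
qed

text \<open>With \<open>a\<close> the sum of the tail series and \<open>0 \<le> y \<le> 1\<close>, this constant satisfies
\<open>(1 + 2 * exp 2 * y) * (1 + a * y) \<le> 1 + trace_constant * y\<close>.\<close>

definition trace_constant :: real
  where "trace_constant = suminf tail_term + 2 * exp 2 * (1 + suminf tail_term)"

lemma trace_constant_pos: "0 < trace_constant"
  unfolding trace_constant_def
  by (intro add_nonneg_pos mult_pos_pos suminf_nonneg summable_tail_term tail_term_nonneg
      add_pos_nonneg) auto

text \<open>The factors \<open>2 ^ card (V - T)\<close> and \<open>(exp (- c) / n) ^ card (V - T)\<close> combine, and the sum over \<open>T\<close> is the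
expansion of \<open>(1 + 2 exp (- c) / n) ^ n \<le> exp (2 exp (- c))\<close>.\<close>

lemma sum_diagonal_le:
  fixes c :: real
  assumes V: "finite V" and n: "0 < card V" and c: "0 \<le> c"
    and k: "0 < k" "4 * real k = real (card V) * (ln (card V) + c)"
  shows "(\<Sum>T\<in>Pow V. \<Sum>A\<in>subsets_of_card V t. (swap_sum T ^^ (2 * k)) (point_mass A) A) \<le>
    real (card V) ^ (4 * k) * (1 + trace_constant * exp (- c))"
proof -
  let ?n = "card V" and ?y = "exp (- c)" and ?A = "suminf tail_term"
  have A: "0 \<le> ?A" using suminf_nonneg summable_tail_term tail_term_nonneg by blast
  have y: "0 \<le> ?y" "?y \<le> 1" using c by auto
  have "(\<Sum>T\<in>Pow V. \<Sum>A\<in>subsets_of_card V t. (swap_sum T ^^ (2 * k)) (point_mass A) A) \<le>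
      (\<Sum>T\<in>Pow V. (2 * (?y / ?n)) ^ card (V - T) * (real ?n ^ (4 * k) * (1 + ?A * ?y)))"
  proof (rule sum_mono)
    fix T assume "T \<in> Pow V"
    then have T: "T \<subseteq> V" by simp
    have fin: "finite T" using V T by (rule rev_finite_subset)
    have d: "card (V - T) = ?n - card T" using fin T by (rule card_Diff_subset)
    have "(\<Sum>A\<in>subsets_of_card V t. (swap_sum T ^^ (2 * k)) (point_mass A) A) \<le>
        2 ^ card (V - T) *
          (\<Sum>j | 2 * j \<le> card T. real (card T choose j) * swap_eigenvalue (card T) j ^ (2 * k))"
      by (rule sum_swap_sum_power_diagonal_le[OF V T]) simp
    also have "\<dots> \<le> 2 ^ card (V - T) *
        (real ?n ^ (4 * k) * (?y / ?n) ^ (?n - card T) * (1 + ?A * ?y))"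
      by (intro mult_left_mono layer_sum_le card_mono V T n k c) simp
    finally show "(\<Sum>A\<in>subsets_of_card V t. (swap_sum T ^^ (2 * k)) (point_mass A) A) \<le>
        (2 * (?y / ?n)) ^ card (V - T) * (real ?n ^ (4 * k) * (1 + ?A * ?y))"
      unfolding power_mult_distrib d by (simp only: mult_ac)
  qed
  also have "\<dots> = (1 + 2 * (?y / ?n)) ^ ?n * (real ?n ^ (4 * k) * (1 + ?A * ?y))"
    using prod_add[OF V, of "\<lambda>_. 1" "\<lambda>_. 2 * (?y / ?n)"]
    by (simp add: sum_distrib_right)
  also have "\<dots> \<le> exp (2 * ?y) * (real ?n ^ (4 * k) * (1 + ?A * ?y))"
  proof (rule mult_right_mono)
    have "(1 + 2 * (?y / ?n)) ^ ?n \<le> exp (2 * (?y / ?n)) ^ ?n"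
      using n by (intro power_mono exp_ge_add_one_self add_nonneg_nonneg) auto
    then show "(1 + 2 * (?y / ?n)) ^ ?n \<le> exp (2 * ?y)"
      using n by (simp add: exp_of_nat_mult[symmetric])
  qed (use A y in \<open>simp add: add_nonneg_nonneg\<close>)
  also have "exp (2 * ?y) \<le> 1 + 2 * exp 2 * ?y"
  proof -
    have "exp (2 * ?y) * (1 - 2 * ?y) \<le> exp (2 * ?y) * exp (- (2 * ?y))"
      using exp_ge_add_one_self[of "- (2 * ?y)"] by (intro mult_left_mono) auto
    then have "exp (2 * ?y) \<le> 1 + 2 * exp (2 * ?y) * ?y"
      by (simp add: exp_minus_inverse algebra_simps)
    also have "\<dots> \<le> 1 + 2 * exp 2 * ?y"
      using y by (intro add_left_mono mult_right_mono) auto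
    finally show ?thesis .
  qed
  also have "(1 + 2 * exp 2 * ?y) * (real ?n ^ (4 * k) * (1 + ?A * ?y)) =
      real ?n ^ (4 * k) * (1 + ?A * ?y + 2 * exp 2 * ?y + 2 * exp 2 * ?A * (?y * ?y))"
    by (simp add: algebra_simps)
  also have "\<dots> \<le> real ?n ^ (4 * k) * (1 + ?A * ?y + 2 * exp 2 * ?y + 2 * exp 2 * ?A * ?y)"
    using A y by (intro mult_left_mono add_left_mono) (auto intro: mult_left_le)
  also have "\<dots> = real ?n ^ (4 * k) * (1 + trace_constant * ?y)"
    by (simp add: trace_constant_def algebra_simps)
  finally show ?thesis
    using A y by (simp add: mult_right_mono add_nonneg_nonneg)
qed


section \<open>Right convolution and the cosets of the block subgroup\<close>

lemma convolution_eq_sum_left_factor: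
  assumes "group G" "g \<in> carrier G"
  shows "convolution G R1 R2 g =
    (\<Sum>h\<in>carrier G. R1 h * R2 (inv\<^bsub>G\<^esub> h \<otimes>\<^bsub>G\<^esub> g))"
proof -
  interpret group G by fact
  have "g \<otimes>\<^bsub>G\<^esub> inv\<^bsub>G\<^esub> (inv\<^bsub>G\<^esub> h \<otimes>\<^bsub>G\<^esub> g) = h" if "h \<in> carrier G" for h
    using that assms(2) by (simp add: inv_mult_group m_assoc[symmetric])
  moreover have "inv\<^bsub>G\<^esub> (g \<otimes>\<^bsub>G\<^esub> inv\<^bsub>G\<^esub> h) \<otimes>\<^bsub>G\<^esub> g = h" if "h \<in> carrier G" for h
    using that assms(2) by (simp add: inv_mult_group m_assoc)
  ultimately show ?thesis
    unfolding convolution_def using assms(2)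
    by (intro sum.reindex_bij_witness[of _ "\<lambda>h. inv\<^bsub>G\<^esub> h \<otimes>\<^bsub>G\<^esub> g" "\<lambda>h. g \<otimes>\<^bsub>G\<^esub> inv\<^bsub>G\<^esub> h"]) auto
qed

lemma convolution_assoc:
  assumes "group G" "g \<in> carrier G"
  shows "convolution G R1 (convolution G R2 R3) g = convolution G (convolution G R1 R2) R3 g"
proof -
  interpret group G by fact
  have "convolution G R1 (convolution G R2 R3) g =
      (\<Sum>h\<in>carrier G. \<Sum>l\<in>carrier G.
        R1 h * R2 (inv\<^bsub>G\<^esub> h \<otimes>\<^bsub>G\<^esub> g \<otimes>\<^bsub>G\<^esub> inv\<^bsub>G\<^esub> l) * R3 l)"
    unfolding convolution_eq_sum_left_factor[OF assms] convolution_def[of G R2 R3]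
    by (simp only: sum_distrib_left mult.assoc)
  also have "\<dots> = (\<Sum>l\<in>carrier G. \<Sum>h\<in>carrier G.
        R1 h * R2 (inv\<^bsub>G\<^esub> h \<otimes>\<^bsub>G\<^esub> g \<otimes>\<^bsub>G\<^esub> inv\<^bsub>G\<^esub> l) * R3 l)"
    by (rule sum.swap)
  also have "\<dots> = (\<Sum>l\<in>carrier G. convolution G R1 R2 (g \<otimes>\<^bsub>G\<^esub> inv\<^bsub>G\<^esub> l) * R3 l)"
  proof (intro sum.cong refl)
    fix l assume l: "l \<in> carrier G"
    then have "g \<otimes>\<^bsub>G\<^esub> inv\<^bsub>G\<^esub> l \<in> carrier G" using assms by simp
    moreover have "inv\<^bsub>G\<^esub> h \<otimes>\<^bsub>G\<^esub> g \<otimes>\<^bsub>G\<^esub> inv\<^bsub>G\<^esub> l = inv\<^bsub>G\<^esub> h \<otimes>\<^bsub>G\<^esub> (g \<otimes>\<^bsub>G\<^esub> inv\<^bsub>G\<^esub> l)"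
      if "h \<in> carrier G" for h
      using that l assms by (intro m_assoc) auto
    ultimately show "(\<Sum>h\<in>carrier G.
        R1 h * R2 (inv\<^bsub>G\<^esub> h \<otimes>\<^bsub>G\<^esub> g \<otimes>\<^bsub>G\<^esub> inv\<^bsub>G\<^esub> l) * R3 l) =
        convolution G R1 R2 (g \<otimes>\<^bsub>G\<^esub> inv\<^bsub>G\<^esub> l) * R3 l"
      by (simp add: convolution_eq_sum_left_factor[OF \<open>group G\<close>] sum_distrib_right cong: sum.cong)
  qed
  finally show ?thesis
    by (simp add: convolution_def[of G "convolution G R1 R2"])
qed

text \<open>The recursion multiplies new increments on the left; by associativity they may just as well be appended on the
right. There they give a chain on left cosets whose transition probabilities are invariant under \<open>G\<close>.\<close>

lemma conv_power_Suc_right: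
  assumes "group G" "finite (carrier G)" "g \<in> carrier G"
  shows "conv_power G R (Suc k) g = convolution G (conv_power G R k) R g"
  using assms(3)
proof (induction k arbitrary: g)
  case 0
  interpret group G by fact
  have eq: "g \<otimes>\<^bsub>G\<^esub> inv\<^bsub>G\<^esub> h = \<one>\<^bsub>G\<^esub> \<longleftrightarrow> h = g" if "h \<in> carrier G" for h
    using inv_solve_right[of "\<one>\<^bsub>G\<^esub>" g h] that 0 by auto
  have "convolution G R (conv_power G R 0) g =
      (\<Sum>h\<in>carrier G. if h = \<one>\<^bsub>G\<^esub> then R (g \<otimes>\<^bsub>G\<^esub> inv\<^bsub>G\<^esub> h) else 0)"
    unfolding convolution_def by (intro sum.cong refl) simp
  also have "\<dots> = R g"
    using assms(2) 0 by simp
  finally have 1: "convolution G R (conv_power G R 0) g = R g" .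
  have "convolution G (conv_power G R 0) R g = (\<Sum>h\<in>carrier G. if h = g then R h else 0)"
    unfolding convolution_def using eq by (intro sum.cong refl) simp
  also have "\<dots> = R g"
    using assms(2) 0 by simp
  finally show ?case
    using 1 by simp
next
  case (Suc k)
  interpret group G by fact
  have "conv_power G R (Suc (Suc k)) g = convolution G R (convolution G (conv_power G R k) R) g"
    unfolding conv_power.simps(2)[of G R "Suc k"] convolution_def[of G R]
    using Suc.IH by (intro sum.cong refl) simp
  then show ?case
    by (simp add: convolution_assoc[OF \<open>group G\<close> Suc.prems])
qed

text \<open>The permutations in one left coset of the block subgroup: \<open>A\<close> is the common image of the first block.\<close>

definition block_images :: "nat \<Rightarrow> nat \<Rightarrow> nat set \<Rightarrow> (nat \<Rightarrow> nat) set"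
  where "block_images n r A = {\<pi>. \<pi> permutes {1..n} \<and> \<pi> ` {1..r} = A}"

lemma block_perms_eq_block_images:
  assumes "r \<le> n"
  shows "block_perms n r = block_images n r {1..r}"
proof -
  have "\<kappa> ` {r + 1..n} = {r + 1..n}" if "\<kappa> permutes {1..n}" "\<kappa> ` {1..r} = {1..r}" for \<kappa>
  proof -
    have "{r + 1..n} = {1..n} - {1..r}" using assms by auto
    then show ?thesis
      using that by (simp add: image_set_diff permutes_inj permutes_image del: atLeastAtMost_insertL)
  qed
  then show ?thesis
    by (auto simp: block_perms_def block_images_def sym_group_carrier)
qed

lemma block_images_disjoint: "A \<noteq> B \<Longrightarrow> block_images n r A \<inter> block_images n r B = {}"
  by (auto simp: block_images_def)

lemma finite_block_images [simp]: "finite (block_images n r A)"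
  by (rule finite_subset[OF _ finite_permutations[of "{1..n}"]]) (auto simp: block_images_def)

lemma first_block_in_subsets_of_card: "r \<le> n \<Longrightarrow> {1..r} \<in> subsets_of_card {1..n} r"
  by (auto simp: subsets_of_card_def)

lemma block_images_nonempty:
  assumes "r \<le> n" "A \<in> subsets_of_card {1..n} r"
  shows "block_images n r A \<noteq> {}"
proof -
  obtain p where "p permutes {1..n}" "p ` {1..r} = A"
    by (rule ex_permutes_image[OF _ first_block_in_subsets_of_card[OF assms(1)] assms(2)]) simp
  then show ?thesis by (auto simp: block_images_def)
qed

text \<open>The symmetric group is the disjoint union of these sets over the \<open>r\<close>-subsets \<open>A\<close>, and left multiplication
by suitable permutations maps any one of them bijectively onto any other.\<close>

lemma card_block_images:
  assumes r: "r \<le> n" and A: "A \<in> subsets_of_card {1..n} r"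
  shows "real (card (block_images n r A)) = fact r * fact (n - r)"
proof -
  let ?\<Omega> = "subsets_of_card {1..n} r"
  have eq: "card (block_images n r B) = card (block_images n r A)" if B: "B \<in> ?\<Omega>" for B
  proof -
    obtain p where p: "p permutes {1..n}" "p ` A = B"
      by (rule ex_permutes_image[OF _ A B]) simp
    have p': "inv' p permutes {1..n}" "inv' p ` B = A"
      by (rule permutes_inv[OF p(1)], simp add: p(2)[symmetric] image_comp permutes_inv_o[OF p(1)])
    have "bij_betw (\<lambda>\<pi>. inv' p \<circ> \<pi>) (block_images n r B) (block_images n r A)"
    proof (rule bij_betwI[where g = "\<lambda>\<pi>. p \<circ> \<pi>"])
      show "(\<lambda>\<pi>. inv' p \<circ> \<pi>) \<in> block_images n r B \<rightarrow> block_images n r A"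
        using p' by (auto simp: block_images_def permutes_compose simp flip: image_comp)
      show "(\<lambda>\<pi>. p \<circ> \<pi>) \<in> block_images n r A \<rightarrow> block_images n r B"
        using p by (auto simp: block_images_def permutes_compose simp flip: image_comp)
    qed (simp_all add: o_assoc permutes_inv_o[OF p(1)])
    then show ?thesis by (rule bij_betw_same_card)
  qed
  have "{\<pi>. \<pi> permutes {1..n}} = (\<Union>B\<in>?\<Omega>. block_images n r B)"
    using permutes_image_subsets_of_card[OF _ first_block_in_subsets_of_card[OF r]]
    by (auto simp: block_images_def)
  then have "fact n = card (\<Union>B\<in>?\<Omega>. block_images n r B)"
    using card_permutations[of "{1..n}" n] by simp
  also have "\<dots> = (\<Sum>B\<in>?\<Omega>. card (block_images n r B))"
    by (rule card_UN_disjoint) (auto simp: block_images_disjoint)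
  also have "\<dots> = (n choose r) * card (block_images n r A)"
    using eq by (simp add: card_subsets_of_card)
  finally have "(fact n :: nat) = (n choose r) * card (block_images n r A)" .
  moreover have "(fact n :: nat) = fact r * fact (n - r) * (n choose r)"
    using binomial_fact_lemma[OF r] by simp
  ultimately have "card (block_images n r A) = fact r * fact (n - r)"
    using r by (simp add: mult.commute)
  then show ?thesis by simp
qed

lemma hyperoctahedral_inv:
  assumes "w \<in> bit_vecs n" "\<sigma> permutes {1..n}"
  shows "inv\<^bsub>hyperoctahedral n\<^esub> (w, \<sigma>) = (\<lambda>i. w (\<sigma> i), inv' \<sigma>)"
proof -
  interpret group "hyperoctahedral n" by (rule group_hyperoctahedral)
  have "a + a = 0" for a :: bit
    by (cases a) simp_all
  then show ?thesis
    using assms bit_vecs_permute permutes_inv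
    by (intro inv_equality) (simp_all add: hyperoctahedral_mult hyperoctahedral_one
        hyperoctahedral_carrier_iff permutes_inv_inv permutes_inv_o)
qed

text \<open>Right multiplication by \<open>K\<close> keeps the sign vector and changes the permutation only within the set of those
with the same image of the first block.\<close>

lemma mem_set_mult_block_subgroup:
  assumes r: "r \<le> n" and A: "A \<subseteq> carrier (hyperoctahedral n)" and \<tau>: "\<tau> permutes {1..n}"
  shows "(u, \<tau>) \<in> A <#>\<^bsub>hyperoctahedral n\<^esub> block_subgroup n r \<longleftrightarrow>
    (\<exists>\<sigma>. (u, \<sigma>) \<in> A \<and> \<tau> ` {1..r} = \<sigma> ` {1..r})"
proof
  assume "(u, \<tau>) \<in> A <#>\<^bsub>hyperoctahedral n\<^esub> block_subgroup n r"
  then obtain v \<sigma> \<kappa> where *: "(v, \<sigma>) \<in> A" "\<kappa> \<in> block_images n r {1..r}"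
      "(u, \<tau>) = (v, \<sigma>) \<otimes>\<^bsub>hyperoctahedral n\<^esub> (\<lambda>i. 0, \<kappa>)"
    by (auto simp: set_mult_def block_subgroup_def block_perms_eq_block_images[OF r])
  then have "u = v" "\<tau> = \<sigma> \<circ> \<kappa>"
    by (simp_all add: hyperoctahedral_mult del: add_bit_eq_xor)
  moreover from this have "\<tau> ` {1..r} = \<sigma> ` {1..r}"
    using *(2) by (simp only: block_images_def mem_Collect_eq image_comp[symmetric])
  ultimately show "\<exists>\<sigma>. (u, \<sigma>) \<in> A \<and> \<tau> ` {1..r} = \<sigma> ` {1..r}"
    using *(1) by blast
next
  assume "\<exists>\<sigma>. (u, \<sigma>) \<in> A \<and> \<tau> ` {1..r} = \<sigma> ` {1..r}"
  then obtain \<sigma> where \<sigma>: "(u, \<sigma>) \<in> A" "\<tau> ` {1..r} = \<sigma> ` {1..r}" by blast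
  then have p: "\<sigma> permutes {1..n}"
    using A by (auto simp: hyperoctahedral_carrier_iff)
  define \<kappa> where "\<kappa> = inv' \<sigma> \<circ> \<tau>"
  have "\<kappa> permutes {1..n}"
    unfolding \<kappa>_def by (intro permutes_compose \<tau> permutes_inv p)
  moreover have "\<kappa> ` {1..r} = {1..r}"
    unfolding \<kappa>_def image_comp[symmetric] \<sigma>(2) by (simp add: image_comp permutes_inv_o[OF p])
  ultimately have "(\<lambda>i. 0, \<kappa>) \<in> block_subgroup n r"
    by (simp add: block_subgroup_def block_perms_eq_block_images[OF r] block_images_def)
  moreover have "(u, \<tau>) = (u, \<sigma>) \<otimes>\<^bsub>hyperoctahedral n\<^esub> (\<lambda>i. 0, \<kappa>)"
    by (simp add: hyperoctahedral_mult \<kappa>_def o_assoc permutes_inv_o[OF p] del: add_bit_eq_xor)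
  ultimately show "(u, \<tau>) \<in> A <#>\<^bsub>hyperoctahedral n\<^esub> block_subgroup n r"
    using \<sigma>(1) by (auto simp: set_mult_def)
qed

lemma l_coset_block_subgroup:
  assumes r: "r \<le> n" and x: "(v, \<sigma>) \<in> carrier (hyperoctahedral n)"
  shows "(v, \<sigma>) <#\<^bsub>hyperoctahedral n\<^esub> block_subgroup n r = {v} \<times> block_images n r (\<sigma> ` {1..r})"
proof (rule Set.set_eqI, rule iffI)
  interpret group "hyperoctahedral n" by (rule group_hyperoctahedral)
  let ?K = "block_subgroup n r"
  have sub: "{(v, \<sigma>)} \<subseteq> carrier (hyperoctahedral n)" using x by simp
  fix g :: signed_perm
  obtain u \<tau> where g: "g = (u, \<tau>)" by (cases g)
  show "g \<in> {v} \<times> block_images n r (\<sigma> ` {1..r})" if "g \<in> (v, \<sigma>) <#\<^bsub>hyperoctahedral n\<^esub> ?K"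
  proof -
    have "g \<in> carrier (hyperoctahedral n)"
      using that x subgroup.subset[OF subgroup_block_subgroup] l_coset_subset_G by blast
    then have "\<tau> permutes {1..n}" by (simp add: g hyperoctahedral_carrier_iff)
    then show ?thesis
      using that mem_set_mult_block_subgroup[OF r sub, of \<tau> u]
      by (auto simp: g l_coset_eq_set_mult block_images_def)
  qed
  show "g \<in> (v, \<sigma>) <#\<^bsub>hyperoctahedral n\<^esub> ?K" if "g \<in> {v} \<times> block_images n r (\<sigma> ` {1..r})"
    using that mem_set_mult_block_subgroup[OF r sub, of \<tau> u]
    by (auto simp: g l_coset_eq_set_mult block_images_def)
qed

lemma lcosets_block_subgroup:
  assumes r: "r \<le> n"
  shows "lcosets\<^bsub>hyperoctahedral n\<^esub> (block_subgroup n r) =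
    (\<lambda>(v, A). {v} \<times> block_images n r A) ` (bit_vecs n \<times> subsets_of_card {1..n} r)"
proof -
  let ?G = "hyperoctahedral n" and ?K = "block_subgroup n r"
  have "lcosets\<^bsub>?G\<^esub> ?K = (\<lambda>g. g <#\<^bsub>?G\<^esub> ?K) ` carrier ?G"
    by (auto simp: LCOSETS_def)
  also have "\<dots> = (\<lambda>(v, \<sigma>). {v} \<times> block_images n r (\<sigma> ` {1..r})) ` carrier ?G"
    by (intro image_cong refl) (auto simp: l_coset_block_subgroup[OF r])
  also have "\<dots> = (\<lambda>(v, A). {v} \<times> block_images n r A) `
      (\<lambda>(v, \<sigma>). (v, \<sigma> ` {1..r})) ` carrier ?G"
    by (simp add: image_image case_prod_unfold)
  also have "(\<lambda>(v, \<sigma>). (v, \<sigma> ` {1..r})) ` carrier ?G = bit_vecs n \<times> subsets_of_card {1..n} r"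
  proof (rule Set.set_eqI, rule iffI)
    fix x assume "x \<in> bit_vecs n \<times> subsets_of_card {1..n} r"
    then obtain v A where x: "x = (v, A)" "v \<in> bit_vecs n" "A \<in> subsets_of_card {1..n} r"
      by blast
    obtain p where p: "p permutes {1..n}" "p ` {1..r} = A"
      by (rule ex_permutes_image[OF _ first_block_in_subsets_of_card[OF r] x(3)]) simp
    show "x \<in> (\<lambda>(v, \<sigma>). (v, \<sigma> ` {1..r})) ` carrier ?G"
      using x p by (intro rev_image_eqI[of "(v, p)"]) (simp_all add: hyperoctahedral_carrier_iff)
  qed (auto simp: hyperoctahedral_carrier_iff simp del: One_nat_def
      intro: permutes_image_subsets_of_card first_block_in_subsets_of_card[OF r])
  finally show ?thesis .
qed

lemma inj_on_coset_of_state: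
  assumes "r \<le> n"
  shows "inj_on (\<lambda>(v, A). {v} \<times> block_images n r A) (bit_vecs n \<times> subsets_of_card {1..n} r)"
proof (rule inj_onI, clarify)
  fix v A w B
  assume *: "A \<in> subsets_of_card {1..n} r" "{v} \<times> block_images n r A = {w} \<times> block_images n r B"
  obtain \<pi> where "\<pi> \<in> block_images n r A"
    using block_images_nonempty[OF assms *(1)] by blast
  moreover from this have "(v, \<pi>) \<in> {w} \<times> block_images n r B"
    using *(2) by blast
  ultimately show "v = w \<and> A = B"
    by (auto simp: block_images_def)
qed


section \<open>The step distribution as a randomised transposition\<close>

lemma UNIV_bit: "UNIV = {0, 1::bit}"
proof -
  have "x \<in> {0, 1}" for x :: bit by (cases x) simp_all
  then show ?thesis by blast
qed

lemma sum_UNIV_bit: "(\<Sum>a\<in>UNIV. f a) = f 0 + f (1::bit)"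
  by (simp add: UNIV_bit)

definition bit_support :: "('a \<Rightarrow> bit) \<Rightarrow> 'a set"
  where "bit_support u = {l. u l \<noteq> 0}"

text \<open>Adding this vector to a sign vector changes the sign at \<open>i\<close> by \<open>a\<close> and the sign at \<open>j\<close> by \<open>b\<close>; for \<open>i = j\<close> both
changes apply to the same sign. With uniform \<open>a\<close> and \<open>b\<close> the signs at both positions become uniform.\<close>

definition pair_vec :: "'a \<Rightarrow> 'a \<Rightarrow> bit \<Rightarrow> bit \<Rightarrow> 'a \<Rightarrow> bit"
  where "pair_vec i j a b = (\<lambda>l. (if l = i then a else 0) + (if l = j then b else 0))"

text \<open>The number of pairs of bits \<open>(a, b)\<close> that give a prescribed sign vector with support \<open>s\<close> as
\<open>pair_vec i j a b\<close>; see \<open>sum_pair_vec_eq\<close>.\<close>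

definition pair_weight :: "'a set \<Rightarrow> 'a \<Rightarrow> 'a \<Rightarrow> real"
  where "pair_weight s i j = of_bool (s \<subseteq> {i, j}) * (1 + of_bool (i = j))"

text \<open>For \<open>i \<noteq> j\<close> the bits \<open>a\<close> and \<open>b\<close> can be read off from the vector, while for \<open>i = j\<close> only their sum can,
which leaves two choices. This is the origin of the weight.\<close>

lemma sum_pair_vec_eq:
  "(\<Sum>a\<in>UNIV. \<Sum>b\<in>UNIV. of_bool (u = pair_vec i j a b)) = pair_weight (bit_support u) i j"
proof (cases "i = j")
  case True
  have eq: "u = pair_vec j j a b \<longleftrightarrow> bit_support u \<subseteq> {j} \<and> u j = a + b" for a b
  proof
    assume u: "u = pair_vec j j a b"
    show "bit_support u \<subseteq> {j} \<and> u j = a + b"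
      unfolding u pair_vec_def bit_support_def by auto
  next
    assume *: "bit_support u \<subseteq> {j} \<and> u j = a + b"
    then have "u l = 0" if "l \<noteq> j" for l
      using that unfolding bit_support_def by blast
    with * show "u = pair_vec j j a b"
      unfolding pair_vec_def fun_eq_iff by auto
  qed
  show ?thesis
    unfolding True pair_weight_def eq sum_UNIV_bit by (cases "u j") auto
next
  case False
  have eq: "u = pair_vec i j a b \<longleftrightarrow> bit_support u \<subseteq> {i, j} \<and> u i = a \<and> u j = b" for a b
  proof
    assume u: "u = pair_vec i j a b"
    show "bit_support u \<subseteq> {i, j} \<and> u i = a \<and> u j = b"
      unfolding u pair_vec_def bit_support_def using False by auto
  next
    assume *: "bit_support u \<subseteq> {i, j} \<and> u i = a \<and> u j = b"
    then have "u l = 0" if "l \<notin> {i, j}" for l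
      using that unfolding bit_support_def by blast
    with * False show "u = pair_vec i j a b"
      unfolding pair_vec_def fun_eq_iff by auto
  qed
  show ?thesis
    unfolding pair_weight_def eq sum_UNIV_bit using False by (cases "u i"; cases "u j") auto
qed

lemma sum_pair_weight_empty:
  assumes "finite B"
  shows "(\<Sum>i\<in>B. \<Sum>j\<in>B. pair_weight {} i j) = (real (card B))\<^sup>2 + real (card B)"
  using assms by (simp add: pair_weight_def sum.distrib of_bool_def power2_eq_square algebra_simps)

lemma sum_pair_weight_singleton:
  assumes "finite B"
  shows "(\<Sum>i\<in>B. \<Sum>j\<in>B. pair_weight {p} i j) = 2 * real (card B) * of_bool (p \<in> B)"
proof -
  have "pair_weight {p} i j = (if i = p then 1 else 0) + (if j = p then 1 else 0)" for i j
    by (auto simp: pair_weight_def)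
  then show ?thesis
    using assms by (simp add: sum.distrib sum_distrib_left[symmetric])
qed

lemma sum_pair_weight_doubleton:
  assumes "finite B" "p \<noteq> q"
  shows "(\<Sum>i\<in>B. \<Sum>j\<in>B. pair_weight {p, q} i j) = 2 * of_bool (p \<in> B \<and> q \<in> B)"
proof -
  have 1: "pair_weight {p, q} i j = (if i = p then if j = q then 1 else 0 else 0) +
      (if i = q then if j = p then 1 else 0 else 0)" for i j
    using assms(2) by (auto simp: pair_weight_def)
  have 2: "(\<Sum>j\<in>B. if i = x then if j = y then 1 else 0 else (0::real)) =
      (if i = x then if y \<in> B then 1 else 0 else 0)" for i x y
    using assms(1) by simp
  show ?thesis
    unfolding 1 sum.distrib 2 using assms(1) by simp
qed

lemma transpose_image_eq_iff: "transpose i j ` A = A \<longleftrightarrow> (i \<in> A \<longleftrightarrow> j \<in> A)"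
  by (metis in_transpose_image_iff transpose_apply_first transpose_image_eq)

lemma transpose_image_swap:
  "i \<in> A \<Longrightarrow> j \<notin> A \<Longrightarrow> transpose i j ` A = insert j (A - {i})"
  by (auto simp: transpose_def image_iff)

locale two_blocks =
  fixes n r :: nat
  assumes r_le_n: "r \<le> n"
begin

abbreviation "R \<equiv> {1..r}"
abbreviation "C \<equiv> {r + 1..n}"
abbreviation "V \<equiv> {1..n}"
abbreviation "G \<equiv> hyperoctahedral n"
abbreviation "K \<equiv> block_subgroup n r"

lemma blocks: "V = R \<union> C" "R \<inter> C = {}" "finite R" "finite C" "R \<subseteq> V" "C \<subseteq> V"
  using r_le_n by auto

lemma mem_C_iff: "i \<in> V \<Longrightarrow> i \<in> C \<longleftrightarrow> i \<notin> R"
  using r_le_n by auto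

lemma bit_vecs_iff_support: "u \<in> bit_vecs n \<longleftrightarrow> bit_support u \<subseteq> V"
  unfolding bit_vecs_def bit_support_def by blast

lemma support_empty_iff: "bit_support u = {} \<longleftrightarrow> u = (\<lambda>i. 0)"
  by (auto simp: bit_support_def fun_eq_iff)

lemma mem_block_subgroup:
  assumes "\<tau> permutes V"
  shows "(u, \<tau>) \<in> K \<longleftrightarrow> bit_support u = {} \<and> \<tau> ` R = R"
  unfolding block_subgroup_def block_perms_eq_block_images[OF r_le_n] block_images_def
    support_empty_iff using assms by blast

lemma mem_signed_identities_coset:
  assumes \<tau>: "\<tau> permutes V" and A: "A \<subseteq> V"
  shows "(u, \<tau>) \<in> signed_identities A <#>\<^bsub>G\<^esub> K \<longleftrightarrow> (\<exists>p\<in>A. bit_support u = {p}) \<and> \<tau> ` R = R"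
proof -
  have eq: "(u, \<sigma>) \<in> signed_identities A \<longleftrightarrow> \<sigma> = id \<and> (\<exists>p\<in>A. bit_support u = {p})" for u \<sigma>
    unfolding signed_identities_def bit_support_def by blast
  have "signed_identities A \<subseteq> carrier G"
  proof (rule subrelI)
    fix u \<sigma> assume "(u, \<sigma>) \<in> signed_identities A"
    then show "(u, \<sigma>) \<in> carrier G"
      unfolding eq hyperoctahedral_carrier_iff bit_vecs_iff_support using A permutes_id by auto
  qed
  then show ?thesis
    using mem_set_mult_block_subgroup[OF r_le_n _ \<tau>, of "signed_identities A" u]
    unfolding eq by simp
qed

lemma mem_signed_transpositions:
  "(u, \<sigma>) \<in> signed_transpositions n \<longleftrightarrow>
    (\<exists>i\<in>V. \<exists>j\<in>V. i \<noteq> j \<and> \<sigma> = transpose i j \<and> bit_support u \<subseteq> {i, j})"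
  unfolding signed_transpositions_def bit_support_def by blast

lemma signed_transpositions_subset: "signed_transpositions n \<subseteq> carrier G"
proof (rule subrelI)
  fix u \<sigma> assume "(u, \<sigma>) \<in> signed_transpositions n"
  then obtain i j where "i \<in> V" "j \<in> V" "\<sigma> = transpose i j" "bit_support u \<subseteq> {i, j}"
    unfolding mem_signed_transpositions by blast
  then show "(u, \<sigma>) \<in> carrier G"
    unfolding hyperoctahedral_carrier_iff bit_vecs_iff_support
    using transpose_permutes[of i V j] by blast
qed

lemma mem_signed_block_subgroup:
  assumes "u \<in> bit_vecs n" "i \<in> V" "j \<in> V"
  shows "(u, transpose i j) \<in> signed_block_subgroup n r \<longleftrightarrow> (i \<in> R \<longleftrightarrow> j \<in> R)"
  unfolding signed_block_subgroup_def block_perms_eq_block_images[OF r_le_n] block_images_def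
  using assms transpose_permutes[of i V j] transpose_image_eq_iff[of i j R] by blast

lemma mem_T2_coset:
  assumes \<tau>: "\<tau> permutes V" and u: "u \<in> bit_vecs n"
  shows "(u, \<tau>) \<in> T2 n r <#>\<^bsub>G\<^esub> K \<longleftrightarrow>
    \<tau> ` R = R \<and> bit_support u \<noteq> {} \<and>
    (\<exists>i\<in>V. \<exists>j\<in>V. i \<noteq> j \<and> (i \<in> R \<longleftrightarrow> j \<in> R) \<and> bit_support u \<subseteq> {i, j})"
proof -
  have "T2 n r \<subseteq> carrier G"
    using signed_transpositions_subset by (auto simp: T2_def)
  note * = mem_set_mult_block_subgroup[OF r_le_n this \<tau>, of u]
  have mem: "(u, \<sigma>) \<in> T2 n r \<longleftrightarrow> bit_support u \<noteq> {} \<and>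
      (\<exists>i\<in>V. \<exists>j\<in>V. i \<noteq> j \<and> (i \<in> R \<longleftrightarrow> j \<in> R) \<and> \<sigma> = transpose i j \<and> bit_support u \<subseteq> {i, j})" for \<sigma>
  proof -
    have "(u, transpose i j) \<in> K \<longleftrightarrow> bit_support u = {} \<and> (i \<in> R \<longleftrightarrow> j \<in> R)" if "i \<in> V" "j \<in> V" for i j
      using mem_block_subgroup[OF transpose_permutes[OF that]] transpose_image_eq_iff[of i j R]
      by blast
    then show ?thesis
      unfolding T2_def Int_iff Diff_iff mem_signed_transpositions
      using mem_signed_block_subgroup[OF u] by blast
  qed
  have same: "transpose i j ` R = R" if "i \<in> R \<longleftrightarrow> j \<in> R" for i j
    using that transpose_image_eq_iff[of i j R] by blast
  show ?thesis
    unfolding * mem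
  proof (intro iffI; elim exE conjE bexE)
    fix \<sigma> i j
    assume "\<tau> ` R = \<sigma> ` R" "i \<in> V" "j \<in> V" "i \<noteq> j" "(i \<in> R) = (j \<in> R)" "\<sigma> = transpose i j"
      "bit_support u \<noteq> {}" "bit_support u \<subseteq> {i, j}"
    then show "\<tau> ` R = R \<and> bit_support u \<noteq> {} \<and>
        (\<exists>i\<in>V. \<exists>j\<in>V. i \<noteq> j \<and> (i \<in> R) = (j \<in> R) \<and> bit_support u \<subseteq> {i, j})"
      using same[of i j] by metis
  next
    fix i j
    assume "\<tau> ` R = R" "i \<in> V" "j \<in> V" "i \<noteq> j" "(i \<in> R) = (j \<in> R)"
      "bit_support u \<noteq> {}" "bit_support u \<subseteq> {i, j}"
    then show "\<exists>\<sigma>. (bit_support u \<noteq> {} \<and> (\<exists>i\<in>V. \<exists>j\<in>V. i \<noteq> j \<and> (i \<in> R) = (j \<in> R) \<and>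
        \<sigma> = transpose i j \<and> bit_support u \<subseteq> {i, j})) \<and> \<tau> ` R = \<sigma> ` R"
      using same[of i j] by (intro exI[of _ "transpose i j"]) metis
  qed
qed

lemma cross_swap:
  assumes "k \<in> V" "l \<in> V" "(k \<in> R) \<noteq> (l \<in> R)"
  obtains i j where "i \<in> R" "j \<in> C" "transpose k l ` R = insert j (R - {i})" "{k, l} = {i, j}"
proof (cases "k \<in> R")
  case True
  then have "l \<notin> R" "l \<in> C" using assms mem_C_iff[of l] by blast+
  then show ?thesis
    using that[of k l] True transpose_image_swap[OF True] by blast
next
  case False
  then have "l \<in> R" "k \<in> C" using assms mem_C_iff[of k] by blast+
  moreover have "transpose k l ` R = insert k (R - {l})"
    unfolding transpose_commute[of k l] using \<open>l \<in> R\<close> False by (rule transpose_image_swap)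
  ultimately show ?thesis
    using that[of l k] by blast
qed

text \<open>The exchanged points are written with \<open>i\<close> in the first and \<open>j\<close> in the second block, which makes them unique.\<close>

lemma mem_T3_coset:
  assumes \<tau>: "\<tau> permutes V" and u: "u \<in> bit_vecs n"
  shows "(u, \<tau>) \<in> T3 n r <#>\<^bsub>G\<^esub> K \<longleftrightarrow>
    (\<exists>i\<in>R. \<exists>j\<in>C. \<tau> ` R = insert j (R - {i}) \<and> bit_support u \<subseteq> {i, j})"
proof -
  have "T3 n r \<subseteq> carrier G"
    using signed_transpositions_subset by (auto simp: T3_def)
  note * = mem_set_mult_block_subgroup[OF r_le_n this \<tau>, of u]
  have mem: "(u, \<sigma>) \<in> T3 n r \<longleftrightarrow>
      (\<exists>i\<in>V. \<exists>j\<in>V. (i \<in> R) \<noteq> (j \<in> R) \<and> \<sigma> = transpose i j \<and> bit_support u \<subseteq> {i, j})" for \<sigma>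
    unfolding T3_def Diff_iff mem_signed_transpositions
  proof (intro iffI; elim conjE bexE)
    fix i j assume "(u, \<sigma>) \<notin> signed_block_subgroup n r" "i \<in> V" "j \<in> V" "\<sigma> = transpose i j"
      "bit_support u \<subseteq> {i, j}"
    then show "\<exists>i\<in>V. \<exists>j\<in>V. (i \<in> R) \<noteq> (j \<in> R) \<and> \<sigma> = transpose i j \<and> bit_support u \<subseteq> {i, j}"
      using mem_signed_block_subgroup[OF u, of i j] by metis
  next
    fix i j assume *: "i \<in> V" "j \<in> V" "(i \<in> R) \<noteq> (j \<in> R)" "\<sigma> = transpose i j"
      "bit_support u \<subseteq> {i, j}"
    then have "(u, \<sigma>) \<notin> signed_block_subgroup n r"
      using mem_signed_block_subgroup[OF u, of i j] by metis
    then show "(\<exists>i\<in>V. \<exists>j\<in>V. i \<noteq> j \<and> \<sigma> = transpose i j \<and> bit_support u \<subseteq> {i, j}) \<and>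
        (u, \<sigma>) \<notin> signed_block_subgroup n r"
      using * by metis
  qed
  show ?thesis
  proof
    assume "(u, \<tau>) \<in> T3 n r <#>\<^bsub>G\<^esub> K"
    then obtain i j where ij: "i \<in> V" "j \<in> V" "(i \<in> R) \<noteq> (j \<in> R)" "bit_support u \<subseteq> {i, j}"
        "\<tau> ` R = transpose i j ` R"
      unfolding * mem by blast
    obtain p q where "p \<in> R" "q \<in> C" "transpose i j ` R = insert q (R - {p})" "{i, j} = {p, q}"
      by (rule cross_swap[OF ij(1-3)])
    then show "\<exists>i\<in>R. \<exists>j\<in>C. \<tau> ` R = insert j (R - {i}) \<and> bit_support u \<subseteq> {i, j}"
      using ij(4,5) by metis
  next
    assume "\<exists>i\<in>R. \<exists>j\<in>C. \<tau> ` R = insert j (R - {i}) \<and> bit_support u \<subseteq> {i, j}"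
    then obtain i j where ij: "i \<in> R" "j \<in> C" "\<tau> ` R = insert j (R - {i})" "bit_support u \<subseteq> {i, j}"
      by blast
    then have "j \<notin> R" "i \<in> V" "j \<in> V" using blocks by auto
    moreover from this have "\<tau> ` R = transpose i j ` R"
      using ij by (simp only: transpose_image_swap not_False_eq_True)
    ultimately show "(u, \<tau>) \<in> T3 n r <#>\<^bsub>G\<^esub> K"
      unfolding * mem using ij by (intro exI[of _ "transpose i j"]) blast
  qed
qed

lemma sum_pair_weight_same_block:
  assumes "\<tau> ` R = R"
  shows "(\<Sum>i\<in>V. \<Sum>j\<in>V. of_bool (\<tau> ` R = transpose i j ` R) * pair_weight s i j) =
    (\<Sum>i\<in>R. \<Sum>j\<in>R. pair_weight s i j) + (\<Sum>i\<in>C. \<Sum>j\<in>C. pair_weight s i j)"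
proof -
  have split: "(\<Sum>i\<in>V. f i) = (\<Sum>i\<in>R. f i) + (\<Sum>i\<in>C. f i)" for f :: "nat \<Rightarrow> real"
    unfolding blocks(1) by (rule sum.union_disjoint) (rule blocks)+
  have eq: "\<tau> ` R = transpose i j ` R \<longleftrightarrow> (i \<in> R \<longleftrightarrow> j \<in> R)" for i j
    unfolding assms using transpose_image_eq_iff[of i j R] by metis
  have "i \<in> C \<Longrightarrow> i \<notin> R" for i by auto
  then show ?thesis
    unfolding split eq by (simp cong: sum.cong del: atLeastAtMost_iff)
qed

lemma sum_pair_weight_cross_block:
  assumes i: "i \<in> R" and j: "j \<in> C" and \<tau>: "\<tau> ` R = insert j (R - {i})" and s: "s \<subseteq> {i, j}"
  shows "(\<Sum>k\<in>V. \<Sum>l\<in>V. of_bool (\<tau> ` R = transpose k l ` R) * pair_weight s k l) = 2"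
proof -
  have ij: "i \<noteq> j" "j \<notin> R" "i \<in> V" "j \<in> V" using i j blocks by auto
  have iff: "\<tau> ` R = transpose k l ` R \<longleftrightarrow> {i, j} = {k, l}" for k l
  proof
    assume "{i, j} = {k, l}"
    then have "transpose k l = transpose i j"
      using transpose_commute[of i j] by (auto simp: doubleton_eq_iff)
    then show "\<tau> ` R = transpose k l ` R"
      unfolding \<tau> by (simp only: transpose_image_swap[OF i ij(2)])
  next
    assume *: "\<tau> ` R = transpose k l ` R"
    have "transpose k l i \<notin> R" "transpose k l j \<in> R"
      using in_transpose_image_iff[of i k l R] in_transpose_image_iff[of j k l R] ij(1)
      unfolding *[symmetric] \<tau> by blast+
    then have "transpose k l i \<noteq> i" "transpose k l j \<noteq> j"
      using i ij by auto
    then show "{i, j} = {k, l}"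
      using ij(1) by (auto simp: transpose_def split: if_splits)
  qed
  have "of_bool (\<tau> ` R = transpose k l ` R) * pair_weight s k l = pair_weight {i, j} k l" for k l
    unfolding iff pair_weight_def using s ij(1) by auto
  then show ?thesis
    using ij sum_pair_weight_doubleton[of V i j] by simp
qed

lemma sum_pair_weight_zero:
  assumes "\<tau> ` R \<noteq> R"
    and "\<not> (\<exists>i\<in>R. \<exists>j\<in>C. \<tau> ` R = insert j (R - {i}) \<and> s \<subseteq> {i, j})"
  shows "(\<Sum>k\<in>V. \<Sum>l\<in>V. of_bool (\<tau> ` R = transpose k l ` R) * pair_weight s k l) = 0"
proof (intro sum.neutral ballI)
  fix k l assume kl: "k \<in> V" "l \<in> V"
  have "\<not> s \<subseteq> {k, l}" if eq: "\<tau> ` R = transpose k l ` R"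
  proof -
    have "(k \<in> R) \<noteq> (l \<in> R)"
      using assms(1) unfolding eq transpose_image_eq_iff .
    then obtain i j where "i \<in> R" "j \<in> C" "\<tau> ` R = insert j (R - {i})" "{k, l} = {i, j}"
      unfolding eq using cross_swap[OF kl] by blast
    then show ?thesis using assms(2) by auto
  qed
  then show "of_bool (\<tau> ` R = transpose k l ` R) * pair_weight s k l = 0"
    by (auto simp: pair_weight_def)
qed

text \<open>The case distinction in the definition of \<open>P\<close> is the distribution of a uniform pair \<open>(i, j)\<close> together with
uniform bits \<open>(a, b)\<close>, spread evenly over the coset of the resulting state. It remains to count the choices
\<open>(i, j, a, b)\<close> that lead to a given state. If the first block is preserved, \<open>i\<close> and \<open>j\<close> lie in one block; an empty support of
\<open>u\<close> then comes from \<open>r\<^sup>2 + (n - r)\<^sup>2 + n\<close> choices, a one-element support from twice the size of its block, a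
two-element support inside one block from two, and every other support from none. If the first block is not preserved, the
two exchanged points are determined up to order, and exactly two choices remain if they contain the support.\<close>

lemma step_measure_eq_sum_pair_weight:
  assumes \<tau>: "\<tau> permutes V" and u: "u \<in> bit_vecs n"
  shows "step_measure n r (u, \<tau>) =
    (\<Sum>i\<in>V. \<Sum>j\<in>V. of_bool (\<tau> ` R = transpose i j ` R) * pair_weight (bit_support u) i j) /
      (4 * (real n)\<^sup>2 * fact r * fact (n - r))"
    (is "_ = ?c / _")
proof -
  let ?s = "bit_support u"
  define D where "D = 2 * (real n)\<^sup>2 * fact r * fact (n - r)"
  have D: "4 * (real n)\<^sup>2 * fact r * fact (n - r) = 2 * D" by (simp add: D_def)
  have s: "?s \<subseteq> V" using u by (simp only: bit_vecs_iff_support)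
  have id: "(u, \<tau>) \<in> signed_identities A <#>\<^bsub>G\<^esub> K \<longleftrightarrow> (\<exists>p\<in>A. ?s = {p}) \<and> \<tau> ` R = R"
    if "A = R \<or> A = C \<or> A = V" for A
    using mem_signed_identities_coset[OF \<tau>, of A] that blocks by blast
  note mem = mem_block_subgroup[OF \<tau>] id mem_T2_coset[OF \<tau> u] mem_T3_coset[OF \<tau> u]
  have step: "step_measure n r (u, \<tau>) =
      (if ?s = {} \<and> \<tau> ` R = R then (real n * (real n + 1) - 2 * real r * (real n - real r)) / (2 * D)
       else if (\<exists>p\<in>R. ?s = {p}) \<and> \<tau> ` R = R then real r / D
       else if (\<exists>p\<in>C. ?s = {p}) \<and> \<tau> ` R = R then (real n - real r) / D
       else if (\<tau> ` R = R \<and> ?s \<noteq> {} \<and>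
          (\<exists>i\<in>V. \<exists>j\<in>V. i \<noteq> j \<and> (i \<in> R \<longleftrightarrow> j \<in> R) \<and> ?s \<subseteq> {i, j})) \<and>
          \<not> ((\<exists>p\<in>V. ?s = {p}) \<and> \<tau> ` R = R) then 1 / D
       else if \<exists>i\<in>R. \<exists>j\<in>C. \<tau> ` R = insert j (R - {i}) \<and> ?s \<subseteq> {i, j} then 1 / D
       else 0)"
    unfolding step_measure_def Let_def D_def[symmetric] Diff_iff
    by (simp only: mem simp_thms)
  have card: "real (card R) = r" "real (card C) = real n - real r"
    using r_le_n by (simp_all add: of_nat_diff)
  show ?thesis
  proof (cases "\<tau> ` R = R")
    case False
    then show ?thesis
      unfolding step D using sum_pair_weight_cross_block[of _ _ \<tau> ?s] sum_pair_weight_zero[OF False, of ?s]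
      by auto
  next
    case True
    have "\<not> (\<exists>i\<in>R. \<exists>j\<in>C. \<tau> ` R = insert j (R - {i}) \<and> ?s \<subseteq> {i, j})"
      unfolding True using blocks(2) by blast
    note T3 = this[unfolded True]
    have c: "?c = (\<Sum>i\<in>R. \<Sum>j\<in>R. pair_weight ?s i j) + (\<Sum>i\<in>C. \<Sum>j\<in>C. pair_weight ?s i j)"
      by (rule sum_pair_weight_same_block[OF True])
    consider "?s = {}" | p where "?s = {p}" "p \<in> R" | p where "?s = {p}" "p \<in> C"
      | p q where "?s = {p, q}" "p \<noteq> q" | "\<And>i j. \<not> ?s \<subseteq> {i, j}"
    proof (cases "\<exists>i j. ?s \<subseteq> {i, j}")
      case True
      then obtain i j where "?s \<subseteq> {i, j}" by blast
      then consider "?s = {}" | "?s = {i}" | "?s = {j}" | "i \<noteq> j" "?s = {i, j}" by blast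
      moreover have "p \<in> R \<or> p \<in> C" if "?s = {p}" for p
        using s that unfolding blocks(1) by blast
      ultimately show thesis using that(1-4) by metis
    qed (use that(5) in blast)
    then show ?thesis
    proof cases
      case 1
      have hc: "?c = real n * (real n + 1) - 2 * real r * (real n - real r)"
        unfolding c unfolding 1 sum_pair_weight_empty[OF blocks(3)] sum_pair_weight_empty[OF blocks(4)] card
        by (simp add: power2_eq_square algebra_simps)
      show ?thesis unfolding step D hc using 1 True by simp
    next
      case (2 p)
      then have "p \<notin> C" by auto
      then have hc: "?c = 2 * real r"
        unfolding c unfolding 2 sum_pair_weight_singleton[OF blocks(3)] sum_pair_weight_singleton[OF blocks(4)] card
        using 2(2) by simp
      show ?thesis unfolding step D hc using 2 True by simp
    next
      case (3 p)
      then have pR: "p \<notin> R" by auto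
      then have hc: "?c = 2 * (real n - real r)"
        unfolding c unfolding 3 sum_pair_weight_singleton[OF blocks(3)] sum_pair_weight_singleton[OF blocks(4)] card
        using 3(2) by simp
      show ?thesis
        unfolding step D hc mult_divide_mult_cancel_left[OF zero_neq_numeral[symmetric]]
        using 3 True pR by auto
    next
      case (4 p q)
      then have pq: "p \<in> V" "q \<in> V" using s by auto
      have hc: "?c = 2 * of_bool (p \<in> R \<longleftrightarrow> q \<in> R)"
        unfolding c unfolding 4(1) sum_pair_weight_doubleton[OF blocks(3) 4(2)]
          sum_pair_weight_doubleton[OF blocks(4) 4(2)]
        using mem_C_iff[OF pq(1)] mem_C_iff[OF pq(2)] by auto
      have ne: "?s \<noteq> {}" "?s \<noteq> {x}" for x
        using 4 by auto
      have T2: "(\<exists>i\<in>V. \<exists>j\<in>V. i \<noteq> j \<and> (i \<in> R \<longleftrightarrow> j \<in> R) \<and> ?s \<subseteq> {i, j}) \<longleftrightarrow>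
          (p \<in> R \<longleftrightarrow> q \<in> R)"
        unfolding 4(1) using pq 4(2) by blast
      have "step_measure n r (u, \<tau>) = (if p \<in> R \<longleftrightarrow> q \<in> R then 1 / D else 0)"
        unfolding step True
        by (simp only: ne T2 T3 simp_thms bex_triv ball_triv if_True if_False)
      then show ?thesis unfolding D hc by (simp only: of_bool_def) auto
    next
      case 5
      have ne: "?s \<noteq> {}" "?s \<noteq> {x}" for x
        using 5[of x x] 5[of undefined undefined] by auto
      have hc: "?c = 0"
        unfolding c using 5 by (simp add: pair_weight_def)
      show ?thesis
        unfolding step D hc unfolding True by (simp only: ne 5 T3 simp_thms bex_triv if_False div_0)
    qed
  qed
qed

end


section \<open>The Markov chain on cosets\<close>

lemma bit_add_self [simp]: "(a::bit) + a = 0"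
  by (cases a) simp_all

lemma bit_add_eq_iff: "(a::bit) + b = c \<longleftrightarrow> a = b + c"
  by (cases a; cases b; cases c) simp_all

definition bit_sign :: "bit \<Rightarrow> real"
  where "bit_sign a = (if a = 0 then 1 else - 1)"

lemma bit_sign_add: "bit_sign (a + b) = bit_sign a * bit_sign b"
  by (cases a; cases b) (simp_all add: bit_sign_def)

lemma bit_sign_0 [simp]: "bit_sign 0 = 1"
  by (simp add: bit_sign_def)

text \<open>The characters of the group of sign vectors.\<close>

definition sign_character :: "'a set \<Rightarrow> ('a \<Rightarrow> bit) \<Rightarrow> real"
  where "sign_character S v = (\<Prod>l\<in>S. bit_sign (v l))"

lemma sign_character_add:
  "sign_character S (\<lambda>l. v l + w l) = sign_character S v * sign_character S w"
  by (simp add: sign_character_def bit_sign_add prod.distrib del: add_bit_eq_xor)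

lemma sign_character_single:
  assumes "finite S"
  shows "sign_character S (\<lambda>l. if l = i then a else 0) = (if i \<in> S then bit_sign a else 1)"
proof -
  have "sign_character S (\<lambda>l. if l = i then a else 0) = (\<Prod>l\<in>S. if l = i then bit_sign a else 1)"
    unfolding sign_character_def by (intro prod.cong) auto
  then show ?thesis using assms by simp
qed

text \<open>Averaging over random signs at \<open>i\<close> and \<open>j\<close> kills every character that involves one of these positions.\<close>

lemma sum_sign_character_pair_vec:
  assumes "finite S"
  shows "(\<Sum>a\<in>UNIV. \<Sum>b\<in>UNIV. sign_character S (pair_vec i j a b)) =
    4 * of_bool (i \<notin> S \<and> j \<notin> S)"
  unfolding pair_vec_def sign_character_add sign_character_single[OF assms] sum_UNIV_bit
  by (simp add: bit_sign_def)

text \<open>The orthogonality relation follows from the factorisation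
\<open>(\<Sum>S\<subseteq>V. \<Prod>l\<in>S. x\<^sub>l) = (\<Prod>l\<in>V. (1 + x\<^sub>l))\<close>: one factor vanishes as soon as \<open>v\<close> and \<open>w\<close> differ.\<close>

lemma sum_sign_character_mult:
  assumes "finite V" "bit_support v \<subseteq> V" "bit_support w \<subseteq> V"
  shows "(\<Sum>S\<in>Pow V. sign_character S v * sign_character S w) = 2 ^ card V * of_bool (v = w)"
proof -
  have "(\<Sum>S\<in>Pow V. sign_character S v * sign_character S w) =
      (\<Prod>l\<in>V. bit_sign (v l + w l) + 1)"
    by (simp add: prod_add[OF assms(1)] sign_character_add[symmetric] sign_character_def[of _ "\<lambda>l. v l + w l"]
        del: add_bit_eq_xor)
  also have "\<dots> = 2 ^ card V * of_bool (v = w)"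
  proof (cases "v = w")
    case True
    then show ?thesis by (simp del: add_bit_eq_xor)
  next
    case False
    then obtain l where l: "v l \<noteq> w l" by blast
    then have "l \<in> bit_support v \<union> bit_support w"
      unfolding bit_support_def by (auto simp del: bit_not_zero_iff)
    then have "l \<in> V" using assms by blast
    moreover have "bit_sign (v l + w l) + 1 = 0"
      using l by (cases "v l"; cases "w l") (simp_all add: bit_sign_def)
    ultimately have "(\<Prod>l\<in>V. bit_sign (v l + w l) + 1) = 0"
      using assms(1) by (auto simp del: add_bit_eq_xor intro!: prod_zero)
    then show ?thesis using False by simp
  qed
  finally show ?thesis .
qed

context two_blocks
begin

abbreviation "\<Omega> \<equiv> subsets_of_card V r"

lemma finite_bit_vecs: "finite (bit_vecs n)"
  and card_bit_vecs: "card (bit_vecs n) = 2 ^ n"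
proof -
  have "bij_betw bit_support (bit_vecs n) (Pow V)"
  proof (rule bij_betwI[where g = "\<lambda>s l. if l \<in> s then 1 else 0"])
    show "bit_support \<in> bit_vecs n \<rightarrow> Pow V" by (simp add: bit_vecs_iff_support)
    show "(\<lambda>s l. if l \<in> s then 1 else 0) \<in> Pow V \<rightarrow> bit_vecs n"
      unfolding bit_vecs_def by auto
  qed (auto simp: bit_support_def fun_eq_iff)
  then show "finite (bit_vecs n)" "card (bit_vecs n) = 2 ^ n"
    using bij_betw_finite bij_betw_same_card by (fastforce simp: card_Pow)+
qed

lemma parseval:
  "(\<Sum>S\<in>Pow V. (\<Sum>v\<in>bit_vecs n. sign_character S v * f v)\<^sup>2) = 2 ^ n * (\<Sum>v\<in>bit_vecs n. (f v)\<^sup>2)"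
proof -
  have "(\<Sum>S\<in>Pow V. (\<Sum>v\<in>bit_vecs n. sign_character S v * f v)\<^sup>2) =
      (\<Sum>S\<in>Pow V. \<Sum>v\<in>bit_vecs n. \<Sum>w\<in>bit_vecs n.
        sign_character S v * sign_character S w * (f v * f w))"
    unfolding power2_eq_square sum_product by (simp only: mult_ac)
  also have "\<dots> = (\<Sum>v\<in>bit_vecs n. \<Sum>w\<in>bit_vecs n.
      (\<Sum>S\<in>Pow V. sign_character S v * sign_character S w) * (f v * f w))"
    unfolding sum_distrib_right
    by (subst sum.swap, intro sum.cong refl, rule sum.swap)
  also have "\<dots> = (\<Sum>v\<in>bit_vecs n. \<Sum>w\<in>bit_vecs n. if w = v then 2 ^ n * (f v * f w) else 0)"
  proof (intro sum.cong refl)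
    fix v w assume "v \<in> bit_vecs n" "w \<in> bit_vecs n"
    then have "(\<Sum>S\<in>Pow V. sign_character S v * sign_character S w) = 2 ^ card V * of_bool (v = w)"
      by (intro sum_sign_character_mult) (simp_all add: bit_vecs_iff_support)
    then show "(\<Sum>S\<in>Pow V. sign_character S v * sign_character S w) * (f v * f w) =
        (if w = v then 2 ^ n * (f v * f w) else 0)"
      by auto
  qed
  also have "\<dots> = 2 ^ n * (\<Sum>v\<in>bit_vecs n. (f v)\<^sup>2)"
    by (simp add: finite_bit_vecs sum_distrib_left power2_eq_square)
  finally show ?thesis .
qed

lemma finite_carrier: "finite (carrier G)"
proof -
  have "carrier G = bit_vecs n \<times> {\<pi>. \<pi> permutes V}"
    by (auto simp: hyperoctahedral_carrier_iff)
  then show ?thesis by (simp add: finite_bit_vecs finite_permutations)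
qed

abbreviation "walk k \<equiv> conv_power G (step_measure n r) k"

definition coset_mass :: "nat \<Rightarrow> (nat \<Rightarrow> bit) \<Rightarrow> nat set \<Rightarrow> real"
  where "coset_mass k v A = coset_measure (walk k) ({v} \<times> block_images n r A)"

lemma coset_mass_eq_sum: "coset_mass k v A = (\<Sum>\<pi>\<in>block_images n r A. walk k (v, \<pi>))"
proof -
  have "{v} \<times> block_images n r A = Pair v ` block_images n r A" by auto
  then show ?thesis
    unfolding coset_mass_def coset_measure_def by (simp add: sum.reindex inj_on_def)
qed

lemma coset_mass_eq_sum_carrier:
  assumes "v \<in> bit_vecs n"
  shows "coset_mass k v A = (\<Sum>h\<in>carrier G. of_bool (fst h = v \<and> snd h ` R = A) * walk k h)"
proof -
  have "{v} \<times> block_images n r A = {h \<in> carrier G. fst h = v \<and> snd h ` R = A}"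
    using assms by (auto simp: hyperoctahedral_carrier_iff block_images_def)
  then show ?thesis
    unfolding coset_mass_def coset_measure_def
    using finite_carrier by (simp add: sum.inter_filter of_bool_def if_distrib[of "\<lambda>x. x * _"] cong: if_cong)
qed

lemma coset_mass_0: "coset_mass 0 v A = of_bool (v = (\<lambda>i. 0)) * point_mass R A"
proof -
  have "coset_mass 0 v A =
      (\<Sum>\<pi>\<in>block_images n r A. if \<pi> = id then of_bool (v = (\<lambda>i. 0)) else 0)"
    unfolding coset_mass_eq_sum by (intro sum.cong) (auto simp: hyperoctahedral_one)
  also have "\<dots> = of_bool (id \<in> block_images n r A) * of_bool (v = (\<lambda>i. 0))"
    by simp
  also have "id \<in> block_images n r A \<longleftrightarrow> A = R"
    unfolding block_images_def using permutes_id[of V] by auto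
  finally show ?thesis by simp
qed

text \<open>Here the left invariance of \<open>P\<close> enters: conjugation by \<open>\<sigma>\<close> turns the positions \<open>i\<close> and \<open>j\<close> relative to the
current state into \<open>\<sigma> i\<close> and \<open>\<sigma> j\<close>, and the sum runs over all pairs anyway. The result depends on \<open>\<sigma>\<close> only
through the image of the first block and on \<open>\<pi>\<close> only through \<open>A\<close>.\<close>

lemma step_measure_increment:
  assumes v: "v \<in> bit_vecs n" and w: "w \<in> bit_vecs n"
    and \<sigma>: "\<sigma> permutes V" and \<pi>: "\<pi> \<in> block_images n r A"
  shows "step_measure n r (inv\<^bsub>G\<^esub> (w, \<sigma>) \<otimes>\<^bsub>G\<^esub> (v, \<pi>)) =
    (\<Sum>i\<in>V. \<Sum>j\<in>V. of_bool (\<sigma> ` R = transpose i j ` A) *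
      pair_weight (bit_support (\<lambda>l. w l + v l)) i j) / (4 * (real n)\<^sup>2 * fact r * fact (n - r))"
proof -
  let ?u = "\<lambda>l. w l + v l"
  have \<pi>': "\<pi> permutes V" "\<pi> ` R = A" using \<pi> by (auto simp: block_images_def)
  have u: "?u \<in> bit_vecs n"
    using v w by (simp add: bit_vecs_def del: add_bit_eq_xor)
  have prod: "inv\<^bsub>G\<^esub> (w, \<sigma>) \<otimes>\<^bsub>G\<^esub> (v, \<pi>) = (\<lambda>l. ?u (\<sigma> l), inv' \<sigma> \<circ> \<pi>)"
    by (simp add: hyperoctahedral_inv[OF w \<sigma>] hyperoctahedral_mult permutes_inv_inv[OF \<sigma>]
        del: add_bit_eq_xor)
  have perm: "inv' \<sigma> \<circ> \<pi> permutes V"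
    by (intro permutes_compose \<pi>' permutes_inv \<sigma>)
  have supp: "bit_support (\<lambda>l. ?u (\<sigma> l)) \<subseteq> {i, j} \<longleftrightarrow> bit_support ?u \<subseteq> {\<sigma> i, \<sigma> j}" for i j
  proof -
    have "(\<forall>l. P (\<sigma> l) \<longrightarrow> l \<in> {i, j}) \<longleftrightarrow> (\<forall>l. P l \<longrightarrow> l \<in> {\<sigma> i, \<sigma> j})" for P
      by (metis insert_iff permutes_inverses[OF \<sigma>] singletonD)
    from this[of "\<lambda>l. ?u l \<noteq> 0"] show ?thesis
      unfolding bit_support_def subset_iff mem_Collect_eq .
  qed
  have weight: "pair_weight (bit_support (\<lambda>l. ?u (\<sigma> l))) i j = pair_weight (bit_support ?u) (\<sigma> i) (\<sigma> j)" for i j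
    unfolding pair_weight_def supp using permutes_inj[OF \<sigma>] by (simp add: inj_eq)
  have conj: "(inv' \<sigma> \<circ> \<pi>) ` R = transpose i j ` R \<longleftrightarrow> \<sigma> ` R = transpose (\<sigma> i) (\<sigma> j) ` A" for i j
  proof -
    have "(inv' \<sigma> \<circ> \<pi>) ` R = inv' \<sigma> ` A"
      unfolding image_comp[symmetric] \<pi>'(2) ..
    moreover have "inv' \<sigma> ` A = transpose i j ` R \<longleftrightarrow> A = \<sigma> ` transpose i j ` R"
      by (metis \<sigma> bij_is_surj image_inv_f_f image_f_inv_f permutes_bij permutes_inj)
    moreover have "A = transpose a b ` B \<longleftrightarrow> B = transpose a b ` A" for a b and B :: "nat set"
    proof -
      have inv: "transpose a b ` transpose a b ` X = X" for X :: "nat set"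
        by (simp add: image_comp)
      show ?thesis using inv[of A] inv[of B] by auto
    qed
    ultimately show ?thesis
      unfolding transpose_image_permutes[OF \<sigma>, symmetric] by simp
  qed
  have "step_measure n r (\<lambda>l. ?u (\<sigma> l), inv' \<sigma> \<circ> \<pi>) =
      (\<Sum>i\<in>V. \<Sum>j\<in>V. of_bool (\<sigma> ` R = transpose (\<sigma> i) (\<sigma> j) ` A) *
        pair_weight (bit_support ?u) (\<sigma> i) (\<sigma> j)) / (4 * (real n)\<^sup>2 * fact r * fact (n - r))"
    unfolding step_measure_eq_sum_pair_weight[OF perm bit_vecs_permute[OF u \<sigma>]] weight conj ..
  also have "(\<Sum>i\<in>V. \<Sum>j\<in>V. of_bool (\<sigma> ` R = transpose (\<sigma> i) (\<sigma> j) ` A) *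
        pair_weight (bit_support ?u) (\<sigma> i) (\<sigma> j)) =
      (\<Sum>i\<in>V. \<Sum>j\<in>V. of_bool (\<sigma> ` R = transpose i j ` A) * pair_weight (bit_support ?u) i j)"
  proof -
    have bij: "(\<Sum>i\<in>V. f (\<sigma> i)) = (\<Sum>i\<in>V. f i)" for f :: "nat \<Rightarrow> real"
      by (rule sum.reindex_bij_betw[OF permutes_imp_bij[OF \<sigma>]])
    show ?thesis
      unfolding bij[of "\<lambda>j. of_bool (\<sigma> ` R = transpose (\<sigma> i) j ` A) * pair_weight (bit_support ?u) (\<sigma> i) j" for i]
      by (rule bij)
  qed
  finally show ?thesis unfolding prod .
qed

text \<open>One step of the chain on states \<open>(v, A)\<close>. The sum over the \<open>r! (n - r)!\<close> permutations \<open>\<pi>\<close> with image \<open>A\<close> cancels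
the factorials in the normalisation of \<open>P\<close>.\<close>

lemma coset_mass_Suc:
  assumes v: "v \<in> bit_vecs n" and A: "A \<in> \<Omega>"
  shows "coset_mass (Suc k) v A =
    (\<Sum>i\<in>V. \<Sum>j\<in>V. \<Sum>a\<in>UNIV. \<Sum>b\<in>UNIV.
      coset_mass k (\<lambda>l. v l + pair_vec i j a b l) (transpose i j ` A)) / (4 * (real n)\<^sup>2)"
proof -
  let ?F = "fact r * fact (n - r) :: real"
  let ?W = "\<lambda>h. \<Sum>i\<in>V. \<Sum>j\<in>V. of_bool (snd h ` R = transpose i j ` A) *
      pair_weight (bit_support (\<lambda>l. fst h l + v l)) i j"
  have Suc: "walk (Suc k) (v, \<pi>) = (\<Sum>h\<in>carrier G. walk k h * (?W h / (4 * (real n)\<^sup>2 * ?F)))"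
    if \<pi>: "\<pi> \<in> block_images n r A" for \<pi>
  proof -
    have g: "(v, \<pi>) \<in> carrier G"
      using v \<pi> by (simp add: hyperoctahedral_carrier_iff block_images_def)
    show ?thesis
      unfolding conv_power_Suc_right[OF group_hyperoctahedral finite_carrier g]
        convolution_eq_sum_left_factor[OF group_hyperoctahedral g]
    proof (intro sum.cong refl)
      fix h assume h: "h \<in> carrier G"
      obtain w \<sigma> where w: "h = (w, \<sigma>)" by (cases h)
      have "w \<in> bit_vecs n" "\<sigma> permutes V"
        using h unfolding w hyperoctahedral_carrier_iff by blast+
      from step_measure_increment[OF v this \<pi>]
      show "walk k h * step_measure n r (inv\<^bsub>G\<^esub> h \<otimes>\<^bsub>G\<^esub> (v, \<pi>)) =
          walk k h * (?W h / (4 * (real n)\<^sup>2 * ?F))"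
        unfolding w by (simp only: fst_conv snd_conv mult.assoc)
    qed
  qed
  have "coset_mass (Suc k) v A =
      real (card (block_images n r A)) * (\<Sum>h\<in>carrier G. walk k h * (?W h / (4 * (real n)\<^sup>2 * ?F)))"
    unfolding coset_mass_eq_sum by (simp only: Suc sum_constant cong: sum.cong)
  also have "\<dots> = (\<Sum>h\<in>carrier G. walk k h * ?W h) / (4 * (real n)\<^sup>2)"
  proof -
    have "?F \<noteq> 0" by simp
    then have "?F * (x * (y / (4 * (real n)\<^sup>2 * ?F))) = x * y / (4 * (real n)\<^sup>2)" for x y
      by (simp add: field_simps)
    then show ?thesis
      unfolding card_block_images[OF r_le_n A] sum_distrib_left sum_divide_distrib
      by (intro sum.cong refl)
  qed
  also have "(\<Sum>h\<in>carrier G. walk k h * ?W h) =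
      (\<Sum>h\<in>carrier G. \<Sum>i\<in>V. \<Sum>j\<in>V. \<Sum>a\<in>UNIV. \<Sum>b\<in>UNIV.
        of_bool (fst h = (\<lambda>l. v l + pair_vec i j a b l) \<and> snd h ` R = transpose i j ` A) * walk k h)"
  proof (intro sum.cong refl)
    fix h :: signed_perm
    have eq: "(\<lambda>l. fst h l + v l) = pair_vec i j a b \<longleftrightarrow> fst h = (\<lambda>l. v l + pair_vec i j a b l)" for i j a b
      unfolding fun_eq_iff bit_add_eq_iff ..
    show "walk k h * ?W h = (\<Sum>i\<in>V. \<Sum>j\<in>V. \<Sum>a\<in>UNIV. \<Sum>b\<in>UNIV.
        of_bool (fst h = (\<lambda>l. v l + pair_vec i j a b l) \<and> snd h ` R = transpose i j ` A) * walk k h)"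
      unfolding sum_pair_vec_eq[symmetric] sum_distrib_left eq of_bool_conj by (simp only: mult_ac)
  qed
  also have "\<dots> = (\<Sum>i\<in>V. \<Sum>j\<in>V. \<Sum>a\<in>UNIV. \<Sum>b\<in>UNIV. \<Sum>h\<in>carrier G.
        of_bool (fst h = (\<lambda>l. v l + pair_vec i j a b l) \<and> snd h ` R = transpose i j ` A) * walk k h)"
    by (simp only: sum.swap[of _ _ "carrier G"])
  also have "\<dots> = (\<Sum>i\<in>V. \<Sum>j\<in>V. \<Sum>a\<in>UNIV. \<Sum>b\<in>UNIV.
      coset_mass k (\<lambda>l. v l + pair_vec i j a b l) (transpose i j ` A))"
  proof (intro sum.cong refl)
    fix i j a b assume ij: "i \<in> V" "j \<in> V"
    have "(\<lambda>l. v l + pair_vec i j a b l) \<in> bit_vecs n"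
      using v ij unfolding bit_vecs_def pair_vec_def by (auto simp del: add_bit_eq_xor)
    then show "(\<Sum>h\<in>carrier G.
        of_bool (fst h = (\<lambda>l. v l + pair_vec i j a b l) \<and> snd h ` R = transpose i j ` A) * walk k h) =
        coset_mass k (\<lambda>l. v l + pair_vec i j a b l) (transpose i j ` A)"
      by (rule coset_mass_eq_sum_carrier[symmetric])
  qed
  finally show ?thesis .
qed

end


section \<open>Fourier transform in the signs and the mixing bound\<close>

lemma sum_swap_sum_power:
  assumes "finite T" "T \<subseteq> V"
  shows "(\<Sum>A\<in>subsets_of_card V t. (swap_sum T ^^ k) f A) =
    (real (card T))\<^sup>2 ^ k * (\<Sum>A\<in>subsets_of_card V t. f A)"
proof -
  have "(swap_sum T ^^ k) (\<lambda>_. 1) A = (real (card T))\<^sup>2 ^ k" for A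
    by (induction k arbitrary: A)
      (simp_all add: swap_sum_def[of _ "(swap_sum T ^^ m) g" for m g] power2_eq_square)
  then show ?thesis
    using swap_sum_power_adjoint[OF assms(2), of k f "\<lambda>_. 1" t]
    by (simp add: sum_distrib_right mult.commute)
qed

lemma tv_dist_le_l2_dist:
  shows "tv_dist X \<mu> \<nu> \<le> 1 / 2 * sqrt (real (card X)) * l2_dist X \<mu> \<nu>"
proof -
  have "(\<Sum>x\<in>X. \<bar>1\<bar> * \<bar>\<mu> x - \<nu> x\<bar>) \<le>
      L2_set (\<lambda>x. 1) X * L2_set (\<lambda>x. \<mu> x - \<nu> x) X"
    by (rule L2_set_mult_ineq)
  then have "(\<Sum>x\<in>X. \<bar>\<mu> x - \<nu> x\<bar>) \<le>
      sqrt (real (card X)) * sqrt (\<Sum>x\<in>X. \<bar>\<mu> x - \<nu> x\<bar>\<^sup>2)"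
    by (simp add: L2_set_def)
  then show ?thesis
    unfolding tv_dist_def l2_dist_def by simp
qed

context two_blocks
begin

lemma bit_vecs_add:
  "v \<in> bit_vecs n \<Longrightarrow> w \<in> bit_vecs n \<Longrightarrow> (\<lambda>l. v l + w l) \<in> bit_vecs n"
  by (simp add: bit_vecs_def del: add_bit_eq_xor)

lemma pair_vec_in_bit_vecs: "i \<in> V \<Longrightarrow> j \<in> V \<Longrightarrow> pair_vec i j a b \<in> bit_vecs n"
  unfolding bit_vecs_def pair_vec_def by auto

lemma sum_bit_vecs_shift:
  assumes "w \<in> bit_vecs n"
  shows "(\<Sum>v\<in>bit_vecs n. f (\<lambda>l. v l + w l)) = (\<Sum>v\<in>bit_vecs n. f v)"
  by (rule sum.reindex_bij_witness[of _ "\<lambda>v l. v l + w l" "\<lambda>v l. v l + w l"])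
    (use assms bit_vecs_add in \<open>auto simp: add.assoc simp del: add_bit_eq_xor\<close>)

definition fourier_mass :: "nat \<Rightarrow> nat set \<Rightarrow> nat set \<Rightarrow> real"
  where "fourier_mass k S A = (\<Sum>v\<in>bit_vecs n. sign_character S v * coset_mass k v A)"

text \<open>Translating the sum over \<open>v\<close> moves the random signs into the character, where \<open>sum_sign_character_pair_vec\<close>
restricts \<open>i\<close> and \<open>j\<close> to the complement of \<open>S\<close>.\<close>

lemma fourier_mass_Suc:
  assumes S: "S \<subseteq> V" and A: "A \<in> \<Omega>"
  shows "fourier_mass (Suc k) S A = swap_sum (V - S) (fourier_mass k S) A / (real n)\<^sup>2"
proof -
  have fin: "finite S" using S by (rule finite_subset) simp
  let ?m = "\<lambda>i j v. coset_mass k v (transpose i j ` A)"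
  have shift: "(\<Sum>v\<in>bit_vecs n. sign_character S v * ?m i j (\<lambda>l. v l + pair_vec i j a b l)) =
      sign_character S (pair_vec i j a b) * fourier_mass k S (transpose i j ` A)"
    if "i \<in> V" "j \<in> V" for i j a b
  proof -
    let ?p = "pair_vec i j a b"
    have "(\<Sum>v\<in>bit_vecs n. sign_character S v * ?m i j (\<lambda>l. v l + ?p l)) =
        (\<Sum>v\<in>bit_vecs n. sign_character S (\<lambda>l. (v l + ?p l) + ?p l) * ?m i j (\<lambda>l. v l + ?p l))"
      by (simp add: add.assoc del: add_bit_eq_xor)
    also have "\<dots> = (\<Sum>v\<in>bit_vecs n. sign_character S (\<lambda>l. v l + ?p l) * ?m i j v)"
      by (rule sum_bit_vecs_shift[OF pair_vec_in_bit_vecs[OF that],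
            where f = "\<lambda>v. sign_character S (\<lambda>l. v l + ?p l) * ?m i j v"])
    finally show ?thesis
      unfolding sign_character_add fourier_mass_def sum_distrib_left by (simp only: mult_ac)
  qed
  have "fourier_mass (Suc k) S A = (\<Sum>v\<in>bit_vecs n. \<Sum>i\<in>V. \<Sum>j\<in>V. \<Sum>a\<in>UNIV. \<Sum>b\<in>UNIV.
      sign_character S v * ?m i j (\<lambda>l. v l + pair_vec i j a b l)) / (4 * (real n)\<^sup>2)"
    unfolding fourier_mass_def sum_divide_distrib[of _ "bit_vecs n"]
    by (intro sum.cong refl) (simp only: coset_mass_Suc[OF _ A] sum_distrib_left times_divide_eq_right)
  also have "(\<Sum>v\<in>bit_vecs n. \<Sum>i\<in>V. \<Sum>j\<in>V. \<Sum>a\<in>UNIV. \<Sum>b\<in>UNIV.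
      sign_character S v * ?m i j (\<lambda>l. v l + pair_vec i j a b l)) =
      (\<Sum>i\<in>V. \<Sum>j\<in>V. \<Sum>a\<in>UNIV. \<Sum>b\<in>UNIV.
      sign_character S (pair_vec i j a b) * fourier_mass k S (transpose i j ` A))"
    unfolding sum.swap[of _ _ "bit_vecs n"] by (intro sum.cong refl shift)
  also have "\<dots> = (\<Sum>i\<in>V. \<Sum>j\<in>V. (\<Sum>a\<in>UNIV. \<Sum>b\<in>UNIV.
      sign_character S (pair_vec i j a b)) * fourier_mass k S (transpose i j ` A))"
    by (simp only: sum_distrib_right)
  also have "\<dots> = (\<Sum>i\<in>V. if i \<in> S then 0 else
      (\<Sum>j\<in>V. if j \<in> S then 0 else 4 * fourier_mass k S (transpose i j ` A)))"
    unfolding sum_sign_character_pair_vec[OF fin] by (intro sum.cong refl) (auto intro!: sum.cong)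
  also have "\<dots> = (\<Sum>i\<in>V - S. \<Sum>j\<in>V - S. 4 * fourier_mass k S (transpose i j ` A))"
  proof -
    have restrict: "(\<Sum>i\<in>V. if i \<in> S then 0 else f i) = (\<Sum>i\<in>V - S. f i)" for f :: "nat \<Rightarrow> real"
      by (rule sum.mono_neutral_cong_right) auto
    show ?thesis unfolding restrict ..
  qed
  also have "\<dots> = 4 * swap_sum (V - S) (fourier_mass k S) A"
    unfolding swap_sum_def sum_distrib_left ..
  finally show ?thesis by simp
qed

lemma fourier_mass_eq:
  assumes S: "S \<subseteq> V" and A: "A \<in> \<Omega>"
  shows "fourier_mass k S A = (swap_sum (V - S) ^^ k) (point_mass R) A / (real n)\<^sup>2 ^ k"
  using A
proof (induction k arbitrary: A)
  case 0
  have "fourier_mass 0 S A = (\<Sum>v\<in>bit_vecs n. if v = (\<lambda>i. 0) then point_mass R A else 0)"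
    unfolding fourier_mass_def coset_mass_0
    by (intro sum.cong refl) (auto simp: sign_character_def)
  also have "\<dots> = point_mass R A"
    using finite_bit_vecs by (simp add: bit_vecs_def)
  finally show ?case by simp
next
  case (Suc k)
  let ?F = "(swap_sum (V - S) ^^ k) (point_mass R)"
  have "swap_sum (V - S) (fourier_mass k S) A = (\<Sum>i\<in>V - S. \<Sum>j\<in>V - S. ?F (transpose i j ` A) / (real n)\<^sup>2 ^ k)"
    unfolding swap_sum_def[of _ "fourier_mass k S"]
  proof (intro sum.cong refl)
    fix i j assume "i \<in> V - S" "j \<in> V - S"
    then have "transpose i j ` A \<in> \<Omega>"
      by (intro permutes_image_subsets_of_card[OF transpose_permutes Suc.prems]) blast+
    then show "fourier_mass k S (transpose i j ` A) = ?F (transpose i j ` A) / (real n)\<^sup>2 ^ k"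
      by (rule Suc.IH)
  qed
  also have "\<dots> = swap_sum (V - S) ?F A / (real n)\<^sup>2 ^ k"
    unfolding swap_sum_def[of _ ?F] by (simp only: sum_divide_distrib)
  finally show ?case
    unfolding fourier_mass_Suc[OF S Suc.prems] by simp
qed

lemma R_in_\<Omega>: "R \<in> \<Omega>"
  by (rule first_block_in_subsets_of_card[OF r_le_n])

text \<open>The total mass is the Fourier component of the trivial character.\<close>

lemma sum_coset_mass:
  assumes "0 < n"
  shows "(\<Sum>v\<in>bit_vecs n. \<Sum>A\<in>\<Omega>. coset_mass k v A) = 1"
proof -
  have "(\<Sum>v\<in>bit_vecs n. \<Sum>A\<in>\<Omega>. coset_mass k v A) = (\<Sum>A\<in>\<Omega>. fourier_mass k {} A)"
    unfolding fourier_mass_def sign_character_def by (subst sum.swap) simp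
  also have "\<dots> = (\<Sum>A\<in>\<Omega>. (swap_sum V ^^ k) (point_mass R) A) / (real n)\<^sup>2 ^ k"
    by (simp add: fourier_mass_eq sum_divide_distrib cong: sum.cong)
  also have "\<dots> = (\<Sum>A\<in>\<Omega>. point_mass R A)"
    using assms sum_swap_sum_power[of V V k "point_mass R" r] by simp
  also have "\<dots> = 1"
    using R_in_\<Omega> by (simp add: of_bool_def)
  finally show ?thesis .
qed

text \<open>Parseval's identity turns the squared masses into squared Fourier components, whose sums over \<open>A\<close> are diagonal
entries at the initial set. The factor \<open>n choose r\<close> is used up in replacing these by a sum over all diagonal
entries.\<close>

lemma sum_coset_mass_squared:
  assumes "0 < n"
  shows "2 ^ n * real (n choose r) * (\<Sum>v\<in>bit_vecs n. \<Sum>A\<in>\<Omega>. (coset_mass k v A)\<^sup>2) =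
    (\<Sum>T\<in>Pow V. \<Sum>A\<in>\<Omega>. (swap_sum T ^^ (2 * k)) (point_mass A) A) / real n ^ (4 * k)"
proof -
  have "2 ^ n * (\<Sum>v\<in>bit_vecs n. \<Sum>A\<in>\<Omega>. (coset_mass k v A)\<^sup>2) =
      (\<Sum>A\<in>\<Omega>. 2 ^ n * (\<Sum>v\<in>bit_vecs n. (coset_mass k v A)\<^sup>2))"
    by (subst sum.swap) (simp add: sum_distrib_left)
  also have "\<dots> = (\<Sum>S\<in>Pow V. \<Sum>A\<in>\<Omega>. (fourier_mass k S A)\<^sup>2)"
    unfolding parseval[symmetric] fourier_mass_def[symmetric] by (rule sum.swap)
  also have "\<dots> = (\<Sum>S\<in>Pow V.
      (\<Sum>A\<in>\<Omega>. ((swap_sum (V - S) ^^ k) (point_mass R) A)\<^sup>2) / real n ^ (4 * k))"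
    unfolding sum_divide_distrib
    by (intro sum.cong refl)
      (simp add: fourier_mass_eq power_divide power_mult[symmetric] mult.commute)
  also have "\<dots> = (\<Sum>S\<in>Pow V. (swap_sum (V - S) ^^ (2 * k)) (point_mass R) R) / real n ^ (4 * k)"
    unfolding sum_divide_distrib
    by (intro sum.cong refl, unfold sum_divide_distrib[symmetric])
      (simp only: sum_swap_sum_power_squared[OF _ _ R_in_\<Omega>] Diff_subset finite_atLeastAtMost)
  also have "(\<Sum>S\<in>Pow V. (swap_sum (V - S) ^^ (2 * k)) (point_mass R) R) =
      (\<Sum>T\<in>Pow V. (swap_sum T ^^ (2 * k)) (point_mass R) R)"
    by (rule sum.reindex_bij_witness[of _ "\<lambda>T. V - T" "\<lambda>S. V - S"]) (auto simp: double_diff)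
  finally show ?thesis
    using sum_swap_sum_power_diagonal[OF _ R_in_\<Omega>, of "2 * k"] by (simp add: mult.assoc mult.left_commute)
qed

lemma sum_lcosets:
  "(\<Sum>x\<in>lcosets\<^bsub>G\<^esub> K. f x) = (\<Sum>v\<in>bit_vecs n. \<Sum>A\<in>\<Omega>. f ({v} \<times> block_images n r A))"
  unfolding lcosets_block_subgroup[OF r_le_n] sum.reindex[OF inj_on_coset_of_state[OF r_le_n]]
  by (simp add: sum.cartesian_product case_prod_unfold)

lemma card_lcosets: "card (lcosets\<^bsub>G\<^esub> K) = 2 ^ n * (n choose r)"
  unfolding lcosets_block_subgroup[OF r_le_n] card_image[OF inj_on_coset_of_state[OF r_le_n]]
  by (simp add: card_cartesian_product card_bit_vecs card_subsets_of_card)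

text \<open>For a probability measure, the squared distance to the uniform one is the sum of the squared masses minus
\<open>1 / card X\<close>.\<close>

lemma card_lcosets_mult_l2_dist_squared:
  assumes "0 < n"
  defines "X \<equiv> lcosets\<^bsub>G\<^esub> K"
  shows "real (card X) * (l2_dist X (coset_measure (walk k)) (uniform_measure X))\<^sup>2 =
    (\<Sum>T\<in>Pow V. \<Sum>A\<in>\<Omega>. (swap_sum T ^^ (2 * k)) (point_mass A) A) / real n ^ (4 * k) - 1"
proof -
  let ?N = "real (card X)"
  have N: "?N = 2 ^ n * real (n choose r)"
    unfolding X_def card_lcosets by simp
  then have pos: "0 < ?N" using r_le_n by simp
  have sum1: "(\<Sum>x\<in>X. coset_measure (walk k) x) = 1"
    unfolding X_def sum_lcosets coset_mass_def[symmetric] by (rule sum_coset_mass[OF assms(1)])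
  have sum2: "?N * (\<Sum>x\<in>X. (coset_measure (walk k) x)\<^sup>2) =
      (\<Sum>T\<in>Pow V. \<Sum>A\<in>\<Omega>. (swap_sum T ^^ (2 * k)) (point_mass A) A) / real n ^ (4 * k)"
    unfolding N unfolding X_def sum_lcosets coset_mass_def[symmetric]
    by (rule sum_coset_mass_squared[OF assms(1)])
  have "(l2_dist X (coset_measure (walk k)) (uniform_measure X))\<^sup>2 =
      (\<Sum>x\<in>X. (coset_measure (walk k) x - 1 / ?N)\<^sup>2)"
    unfolding l2_dist_def uniform_measure_def power2_abs by (simp add: sum_nonneg)
  also have "\<dots> = (\<Sum>x\<in>X. (coset_measure (walk k) x)\<^sup>2 - 2 / ?N * coset_measure (walk k) x + (1 / ?N)\<^sup>2)"
    by (intro sum.cong refl) (simp add: power2_diff)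
  also have "\<dots> = (\<Sum>x\<in>X. (coset_measure (walk k) x)\<^sup>2) - 2 / ?N + ?N * (1 / ?N)\<^sup>2"
    by (simp only: sum.distrib sum_subtractf sum_distrib_left[symmetric] sum1 sum_constant mult_1_right)
  also have "?N * \<dots> = ?N * (\<Sum>x\<in>X. (coset_measure (walk k) x)\<^sup>2) - 1"
    using pos by (simp add: power2_eq_square field_simps)
  finally show ?thesis
    unfolding sum2 .
qed

end

theorem theorem3p1p3:
  shows "\<exists>b>0. \<forall>(n::nat) (r::nat) (c::real) (k::nat).
    1 \<le> r \<longrightarrow> real r \<le> real n / 2 \<longrightarrow> c > 0 \<longrightarrow> real k = 1 / 4 * real n * (ln (real n) + c) \<longrightarrow>
    (let G = hyperoctahedral n;
         X = lcosets\<^bsub>G\<^esub> (block_subgroup n r);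
         \<mu> = coset_measure (conv_power G (step_measure n r) k);
         \<nu> = uniform_measure X
     in tv_dist X \<mu> \<nu> \<le> 1 / 2 * sqrt (2 ^ n * real (n choose r)) * l2_dist X \<mu> \<nu> \<and>
        1 / 2 * sqrt (2 ^ n * real (n choose r)) * l2_dist X \<mu> \<nu> \<le> b * exp (- c / 2))"
proof (intro exI[of _ "1 / 2 * sqrt trace_constant"] conjI allI impI)
  show "0 < 1 / 2 * sqrt trace_constant"
    using trace_constant_pos by simp
next
  fix n r k :: nat and c :: real
  assume r: "1 \<le> r" "real r \<le> real n / 2" and c: "0 < c"
    and k: "real k = 1 / 4 * real n * (ln (real n) + c)"
  interpret two_blocks n r
    using r by unfold_locales linarith
  define X where "X = lcosets\<^bsub>G\<^esub> K"
  let ?d = "l2_dist X (coset_measure (walk k)) (uniform_measure X)"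
  have n: "0 < n" "1 \<le> n" using r by linarith+
  then have "0 < real n * (ln n + c)"
    using c by (intro mult_pos_pos add_nonneg_pos) auto
  then have k': "0 < k" "4 * real k = real (card V) * (ln (card V) + c)"
    using k by auto
  have card: "real (card X) = 2 ^ n * real (n choose r)"
    unfolding X_def card_lcosets by simp
  have "real (card X) * ?d\<^sup>2 \<le> trace_constant * exp (- c)"
  proof -
    have "(\<Sum>T\<in>Pow V. \<Sum>A\<in>\<Omega>. (swap_sum T ^^ (2 * k)) (point_mass A) A) \<le>
        real n ^ (4 * k) * (1 + trace_constant * exp (- c))"
      using sum_diagonal_le[of V c k r] n c k' by simp
    then have "(\<Sum>T\<in>Pow V. \<Sum>A\<in>\<Omega>. (swap_sum T ^^ (2 * k)) (point_mass A) A) / real n ^ (4 * k) \<le>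
        1 + trace_constant * exp (- c)"
      using n by (simp only: pos_divide_le_eq zero_less_power of_nat_0_less_iff mult.commute)
    then show ?thesis
      unfolding X_def card_lcosets_mult_l2_dist_squared[OF n(1)] by linarith
  qed
  then have "sqrt (real (card X) * ?d\<^sup>2) \<le> sqrt (trace_constant * exp (- c))"
    by (rule real_sqrt_le_mono)
  moreover have "sqrt (exp (- c)) = exp (- c / 2)"
    by (rule real_sqrt_unique) (simp_all add: power2_eq_square flip: exp_add)
  moreover have "0 \<le> ?d"
    unfolding l2_dist_def by (simp add: sum_nonneg)
  ultimately have "1 / 2 * sqrt (real (card X)) * ?d \<le> 1 / 2 * sqrt trace_constant * exp (- c / 2)"
    by (simp add: real_sqrt_mult)
  moreover have "tv_dist X (coset_measure (walk k)) (uniform_measure X) \<le>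
      1 / 2 * sqrt (real (card X)) * ?d"
    by (rule tv_dist_le_l2_dist)
  ultimately show "let G = hyperoctahedral n;
         X = lcosets\<^bsub>G\<^esub> (block_subgroup n r);
         \<mu> = coset_measure (conv_power G (step_measure n r) k);
         \<nu> = uniform_measure X
     in tv_dist X \<mu> \<nu> \<le> 1 / 2 * sqrt (2 ^ n * real (n choose r)) * l2_dist X \<mu> \<nu> \<and>
        1 / 2 * sqrt (2 ^ n * real (n choose r)) * l2_dist X \<mu> \<nu> \<le>
          1 / 2 * sqrt trace_constant * exp (- c / 2)"
    unfolding Let_def X_def[symmetric] card[symmetric] by blast
qed

end
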